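(* In the stochastic opinion dynamics described below, let $x\in\{\mathbf 0,\mathbf 1\}$. If $\lambda_{\max}(J(x))>1$, then $\mathbb{P}[\beta(t)\to x]=0$. Conversely, if $\lambda_{\max}(J(x))\le 1$, then $\mathbb{P}[\beta(t)\to x]=1$.
   Context: Let $A=(a_{i,j})$ be a symmetric $n\times n$ matrix with nonnegative entries, the weighted adjacency matrix of an undirected graph $G$ on $\{1,\dots,n\}$ (self-loops allowed) that is connected and not bipartite; let $\deg(i)=\sum_j a_{i,j}$, $D=\mathrm{diag}(\deg(1),\dots,\deg(n))$, $W=D^{-1}A$. Each agent $i$ has a bias parameter $\gamma_i>0$, $\Gamma=\mathrm{diag}(\gamma_1,\dots,\gamma_n)\neq I$. $\mathbf 0,\mathbf 1$ are the all-zeros and all-ones vectors; $J(\mathbf{0})=\Gamma W$ and $J(\mathbf{1})=\Gamma^{-1}W$ (these have real eigenvalues), and $\lambda_{\max}$ denotes the largest eigenvalue. Define $f(\mu,\gamma)=\frac{\gamma\mu}{1+(\gamma-1)\mu}$ for $\mu\in[0,1]$, and for $\beta\in[0,1]^n$ let $\mu_i(\beta)=\frac{1}{\deg(i)}\sum_j a_{i,j}\beta_j$. Dynamics: $\beta_i(1)\in(0,1)$ are given initial values. For each $t\ge1$, conditionally on the history $\mathcal{H}_t$ (all declarations up to time $t$), the declarations $\psi_{i,t+1}\in\{0,1\}$ are independent across $i$ with $\mathbb{P}[\psi_{i,t+1}=1\mid\mathcal{H}_t]=f(\mu_i(\beta(t)),\gamma_i)$, and $\beta_i(t+1)=\frac{t}{t+1}\beta_i(t)+\frac{1}{t+1}\psi_{i,t+1}$.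 *)

theory Defs
  imports "HOL-Probability.Probability"
begin

text \<open>Weighted graph with adjacency matrix A (entries A$i$j), agents indexed by a finite type 'n.\<close>

definition edge_rel :: "real^'n^'n \<Rightarrow> ('n \<times> 'n) set" where
  "edge_rel A = {(i, j). A $ i $ j > 0}"

definition graph_connected :: "real^'n^'n \<Rightarrow> bool" where
  "graph_connected A \<longleftrightarrow> (\<forall>i j. (i, j) \<in> (edge_rel A)\<^sup>*)"

definition graph_bipartite :: "real^'n^'n \<Rightarrow> bool" where
  "graph_bipartite A \<longleftrightarrow> (\<exists>c :: 'n \<Rightarrow> bool. \<forall>i j. A $ i $ j > 0 \<longrightarrow> c i \<noteq> c j)"

definition deg :: "real^'n^'n \<Rightarrow> 'n \<Rightarrow> real" where
  "deg A i = (\<Sum>j\<in>UNIV. A $ i $ j)"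

definition diagm :: "real^'n \<Rightarrow> real^'n^'n" where
  "diagm v = (\<chi> i j. if i = j then v $ i else 0)"

text \<open>W = D^{-1} A\<close>
definition Wmat :: "real^'n^'n \<Rightarrow> real^'n^'n" where
  "Wmat A = diagm (\<chi> i. 1 / deg A i) ** A"

text \<open>J(0) = Gamma W and J(1) = Gamma^{-1} W\<close>
definition Jac :: "real^'n^'n \<Rightarrow> real^'n \<Rightarrow> real^'n \<Rightarrow> real^'n^'n" where
  "Jac A gam x = (if x = vec 0 then diagm gam ** Wmat A
                  else diagm (\<chi> i. 1 / gam $ i) ** Wmat A)"

text \<open>Largest (real) eigenvalue.\<close>
definition lambda_max :: "real^'n^'n \<Rightarrow> real" where
  "lambda_max M = Max {l. \<exists>v. v \<noteq> 0 \<and> M *v v = l *\<^sub>R v}"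

definition fbias :: "real \<Rightarrow> real \<Rightarrow> real" where
  "fbias \<mu> \<gamma> = \<gamma> * \<mu> / (1 + (\<gamma> - 1) * \<mu>)"

definition mu :: "real^'n^'n \<Rightarrow> real^'n \<Rightarrow> 'n \<Rightarrow> real" where
  "mu A b i = (\<Sum>j\<in>UNIV. A $ i $ j * b $ j) / deg A i"

text \<open>Opinion trajectory determined by initial value b1 = beta(1) and declarations
  h t i = psi_{i,t} (used for t >= 2). The value at t = 0 is a dummy.\<close>
fun beta :: "real^'n \<Rightarrow> (nat \<Rightarrow> 'n \<Rightarrow> bool) \<Rightarrow> nat \<Rightarrow> real^'n" where
  "beta b1 h 0 = b1"
| "beta b1 h (Suc t) = (if t = 0 then b1 else
     (\<chi> i. real t / real (Suc t) * beta b1 h t $ i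
            + (if h (Suc t) i then 1 else 0) / real (Suc t)))"

end

theory Submission
  imports Defs "HOL-Real_Asymp.Real_Asymp"
begin

text \<open>
  Exchanging the two declarations swaps \<open>\<^bold>0\<close> with \<open>\<^bold>1\<close> and \<open>\<gamma>\<close> with \<open>1/\<gamma>\<close>, so it suffices to treat
  \<open>x = \<^bold>0\<close>.

  Let \<open>\<lambda>\<close> be the largest eigenvalue of \<open>\<Gamma> W\<close>. Since \<open>A\<close> is symmetric, \<open>\<lambda>\<close> is the maximal Rayleigh quotient of \<open>A\<close>
  with respect to the weights \<open>w\<^sub>i = deg(i)/\<gamma>\<^sub>i\<close> and has a positive eigenvector \<open>u\<close>.
  If \<open>\<lambda> > 1\<close>, let \<open>X\<^sub>t\<close> be the number of declarations up to time \<open>t\<close>, agent \<open>i\<close> being counted with weight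
  \<open>w\<^sub>i u\<^sub>i\<close>. Near \<open>\<^bold>0\<close> its conditional increment is at least \<open>\<kappa> X\<^sub>t/t\<close> with \<open>\<kappa> > 1\<close>, so that \<open>t/X\<^sub>t\<close> is a
  supermartingale as soon as \<open>X\<^sub>t\<close> is large; by Fatou's lemma it does not tend to infinity, which it would if
  \<open>\<beta>(t) \<longlonglongrightarrow> \<^bold>0\<close>.

  If \<open>\<lambda> \<le> 1\<close>, Jensen's inequality (strict, because the graph is connected and not bipartite and \<open>\<Gamma> \<noteq> I\<close>) shows
  that \<open>\<^bold>0\<close> and \<open>\<^bold>1\<close> are the only fixed points of the mean-field map and that the largest eigenvalue at \<open>\<^bold>1\<close>
  exceeds \<open>1\<close>. A Lyapunov function, which exists because \<open>A\<close> is symmetric, makes the squared residuals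
  \<open>r(\<beta>(t))\<close> of the fixed-point equation satisfy \<open>\<Sum> r(\<beta>(t))/(t+1) < \<infinity>\<close> almost surely. As \<open>\<beta>\<close> moves by at most
  \<open>1/(t+1)\<close> at time \<open>t\<close>, it converges to \<open>\<^bold>0\<close> or to \<open>\<^bold>1\<close>, and the first part rules out \<open>\<^bold>1\<close>.
\<close>

section \<open>The bias function\<close>

lemma fbias_pos_den:
  assumes "0 \<le> m" "m \<le> 1" "0 < g"
  shows "1 + (g - 1) * m > (0::real)"
proof (cases "m = 1")
  case False
  then have "1 - m > 0" using assms by simp
  moreover have "g * m \<ge> 0" using assms by simp
  ultimately show ?thesis by (simp add: algebra_simps)
qed (use assms in simp)

text \<open>In the odds \<open>m / (1 - m)\<close> the map \<open>fbias\<close> is multiplication by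
  \<open>g\<close>; replacing \<open>m\<close> by \<open>1 - m\<close> inverts the odds, and the
  factor becomes \<open>1 / g\<close>.\<close>

lemma fbias_flip:
  assumes "0 \<le> m" "m \<le> 1" "0 < g"
  shows "fbias (1 - m) (1 / g) = 1 - fbias m g"
proof -
  have d: "1 + (g - 1) * m > 0" by (rule fbias_pos_den[OF assms])
  have "1 + (1 / g - 1) * (1 - m) = (1 + (g - 1) * m) / g"
    using assms(3) by (simp add: field_simps)
  then have "fbias (1 - m) (1 / g) = (1 - m) / (1 + (g - 1) * m)"
    using assms(3) by (simp add: fbias_def)
  also have "\<dots> = 1 - fbias m g"
    using d by (simp add: fbias_def field_simps)
  finally show ?thesis .
qed

section \<open>The inverse of the bias function\<close>

definition fbias_inv :: "real \<Rightarrow> real \<Rightarrow> real" where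
  "fbias_inv b g = b / (g + (1 - g) * b)"

text \<open>The denominator is the convex combination of \<open>g\<close> and \<open>1\<close> with
  weights \<open>1 - b\<close> and \<open>b\<close>, hence lies between them.\<close>

lemma fbias_inv_den:
  fixes b g :: real
  assumes "0 \<le> b" "b \<le> 1" "0 < g"
  shows "min g 1 \<le> g + (1 - g) * b" "g + (1 - g) * b \<le> max g 1"
proof -
  have e: "g + (1 - g) * b = (1 - b) * g + b * 1" by (simp add: algebra_simps)
  have "(1 - b) * min g 1 + b * min g 1 \<le> (1 - b) * g + b * 1"
    using assms by (intro add_mono mult_left_mono) auto
  then show "min g 1 \<le> g + (1 - g) * b" unfolding e by (simp add: algebra_simps)
  have "(1 - b) * g + b * 1 \<le> (1 - b) * max g 1 + b * max g 1"
    using assms by (intro add_mono mult_left_mono) auto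
  then show "g + (1 - g) * b \<le> max g 1" unfolding e by (simp add: algebra_simps)
qed

lemma fbias_inv_den_pos:
  assumes "0 \<le> b" "b \<le> 1" "0 < g"
  shows "g + (1 - g) * b > (0::real)"
  using fbias_inv_den(1)[OF assms] assms(3) by linarith

text \<open>Over the common denominator the numerator collapses to \<open>g * (a - b)\<close>, and
  both denominators are at least \<open>min g 1\<close>.\<close>

lemma fbias_inv_lipschitz:
  assumes "0 \<le> a" "a \<le> 1" "0 \<le> b" "b \<le> 1" "0 < g"
  shows "\<bar>fbias_inv a g - fbias_inv b g\<bar> \<le> g / (min g 1)\<^sup>2 * \<bar>a - b\<bar>"
proof -
  define p q where "p = g + (1 - g) * a" and "q = g + (1 - g) * b"
  have p: "p > 0" "min g 1 \<le> p" unfolding p_def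
    using fbias_inv_den_pos fbias_inv_den(1) assms by auto
  have q: "q > 0" "min g 1 \<le> q" unfolding q_def
    using fbias_inv_den_pos fbias_inv_den(1) assms by auto
  have "fbias_inv a g - fbias_inv b g = (a * q - b * p) / (p * q)"
    using p q by (simp add: fbias_inv_def p_def[symmetric] q_def[symmetric] diff_frac_eq)
  also have "a * q - b * p = g * (a - b)" by (simp add: p_def q_def algebra_simps)
  finally have "\<bar>fbias_inv a g - fbias_inv b g\<bar> = g * \<bar>a - b\<bar> / (p * q)"
    using p q assms by (simp add: abs_mult)
  also have "\<dots> \<le> g * \<bar>a - b\<bar> / (min g 1 * min g 1)"
    using p q assms by (intro divide_left_mono mult_mono) auto
  finally show ?thesis by (simp add: power2_eq_square)
qed

text \<open>Quadratic upper bound for the antiderivative of a Lipschitz function. Taking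
  \<open>H\<close> abstractly spares the closed form with logarithms and its separate case
  \<open>g = 1\<close>.\<close>

lemma fbias_inv_antiderivative:
  assumes g: "0 < g"
  shows "\<exists>H L. L \<ge> 0 \<and> (\<forall>a\<in>{0..1}. \<forall>b\<in>{0..1}.
    H b \<le> H a + fbias_inv a g * (b - a) + L * (b - a)\<^sup>2)"
proof -
  define L where "L = g / (min g 1)\<^sup>2"
  have L: "L \<ge> 0" using g by (simp add: L_def)
  have "continuous_on {0..1} (\<lambda>b. fbias_inv b g)"
    unfolding fbias_inv_def
    by (intro continuous_intros) (use fbias_inv_den_pos[OF _ _ g] in \<open>force\<close>)
  then obtain H where H: "\<And>x. x \<in> {0..1} \<Longrightarrow> (H has_vector_derivative fbias_inv x g) (at x within {0..1})"
    using antiderivative_continuous by blast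
  have mvt: "\<exists>\<xi>. a \<le> \<xi> \<and> \<xi> \<le> b \<and> H b - H a = fbias_inv \<xi> g * (b - a)" if "0 \<le> a" "a < b" "b \<le> 1" for a b
  proof -
    have "(H has_derivative (\<lambda>h. h * fbias_inv x g)) (at x within {a..b})" if "a \<le> x" "x \<le> b" for x
    proof -
      have "(H has_vector_derivative fbias_inv x g) (at x within {a..b})"
        by (rule has_vector_derivative_within_subset[OF H]) (use that \<open>0 \<le> a\<close> \<open>b \<le> 1\<close> in auto)
      then show ?thesis by (simp add: has_vector_derivative_def)
    qed
    from mvt_simple[OF \<open>a < b\<close> this] obtain \<xi>
      where "\<xi> \<in> {a<..<b}" "H b - H a = (b - a) * fbias_inv \<xi> g" by blast
    then show ?thesis by (intro exI[of _ \<xi>]) (simp add: mult.commute)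
  qed
  have "H b \<le> H a + fbias_inv a g * (b - a) + L * (b - a)\<^sup>2" if ab: "a \<in> {0..1}" "b \<in> {0..1}" for a b
  proof -
    obtain \<xi> where xi: "\<xi> \<in> {0..1}" "\<bar>\<xi> - a\<bar> \<le> \<bar>b - a\<bar>" "H b - H a = fbias_inv \<xi> g * (b - a)"
    proof (cases a b rule: linorder_cases)
      case less
      then obtain \<xi> where "a \<le> \<xi>" "\<xi> \<le> b" "H b - H a = fbias_inv \<xi> g * (b - a)"
        using mvt[of a b] ab by auto
      then show ?thesis using that[of \<xi>] ab by auto
    next
      case equal then show ?thesis using that[of a] ab by simp
    next
      case greater
      then obtain \<xi> where "b \<le> \<xi>" "\<xi> \<le> a" "H a - H b = fbias_inv \<xi> g * (a - b)"
        using mvt[of b a] ab by auto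
      moreover from this(3) have "H b - H a = fbias_inv \<xi> g * (b - a)" by (simp add: algebra_simps)
      ultimately show ?thesis using that[of \<xi>] ab by auto
    qed
    \<comment> \<open>The mean value theorem gives the slope at \<open>\<xi>\<close>; passing to the
      slope at \<open>a\<close> costs at most \<open>L * (b - a)\<^sup>2\<close>.\<close>
    have "(fbias_inv \<xi> g - fbias_inv a g) * (b - a) \<le> \<bar>fbias_inv \<xi> g - fbias_inv a g\<bar> * \<bar>b - a\<bar>"
      by (metis abs_ge_self abs_mult)
    also have "\<dots> \<le> (L * \<bar>\<xi> - a\<bar>) * \<bar>b - a\<bar>"
      unfolding L_def using fbias_inv_lipschitz[of \<xi> a g] xi(1) ab(1) g by (intro mult_right_mono) auto
    also have "\<dots> \<le> (L * \<bar>b - a\<bar>) * \<bar>b - a\<bar>"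
      using xi(2) L by (intro mult_right_mono mult_left_mono) auto
    also have "\<dots> = L * (b - a)\<^sup>2" by (simp add: power2_eq_square abs_mult_self_eq mult.assoc)
    finally show ?thesis using xi(3) by (simp add: algebra_simps)
  qed
  then show ?thesis using L by blast
qed

text \<open>Both factors are multiples of the same \<open>n\<close>, namely \<open>- n / p\<close>
  and \<open>n / q\<close>, so the product is \<open>- (q / p)\<close> times the square of the
  second factor.\<close>

lemma fbias_inv_descent:
  assumes m: "0 \<le> m" "m \<le> 1" and b: "0 \<le> b" "b \<le> 1" and g: "0 < g"
  shows "(fbias_inv b g - m) * (fbias m g - b) \<le> - (min g 1 / max g 1) * (fbias m g - b)\<^sup>2"
proof -
  define p q where "p = g + (1 - g) * b" and "q = 1 + (g - 1) * m"
  have p: "p > 0" "p \<le> max g 1" unfolding p_def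
    using fbias_inv_den_pos[OF b g] fbias_inv_den(2)[OF b g] by auto
  have q: "q > 0" unfolding q_def by (rule fbias_pos_den[OF m g])
  \<comment> \<open>\<open>q\<close> has the shape of the denominator of \<open>fbias_inv\<close>,
    evaluated at \<open>1 - m\<close>.\<close>
  have "q = g + (1 - g) * (1 - m)" by (simp add: q_def algebra_simps)
  then have q2: "min g 1 \<le> q" using fbias_inv_den(1)[of "1 - m" g] m g by simp
  define n where "n = g * m - b - (g - 1) * m * b"
  have "fbias m g - b = (g * m - b * q) / q"
    using q by (simp add: fbias_def q_def[symmetric] diff_divide_distrib)
  then have f: "fbias m g - b = n / q" by (simp add: n_def q_def algebra_simps)
  have "fbias_inv b g - m = (b - m * p) / p"
    using p by (simp add: fbias_inv_def p_def[symmetric] diff_divide_distrib)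
  also have "b - m * p = - n" by (simp add: n_def p_def algebra_simps)
  finally have "(fbias_inv b g - m) * (fbias m g - b) = - (q / p) * (fbias m g - b)\<^sup>2"
    using p q unfolding f by (simp add: power2_eq_square)
  moreover have "min g 1 / max g 1 \<le> q / p"
    using p q q2 g by (intro frac_le) auto
  then have "min g 1 / max g 1 * (fbias m g - b)\<^sup>2 \<le> q / p * (fbias m g - b)\<^sup>2"
    by (rule mult_right_mono) simp
  ultimately show ?thesis by linarith
qed

section \<open>Perron theory of the weighted graph\<close>

locale opinion_graph =
  fixes A :: "real^'n^'n"
  assumes sym: "A $ i $ j = A $ j $ i"
    and nonneg: "A $ i $ j \<ge> 0"
    and conn: "graph_connected A"
    and nonbip: "\<not> graph_bipartite A"
begin

abbreviation adj :: "'n \<Rightarrow> real^'n \<Rightarrow> real" where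
  "adj i v \<equiv> (\<Sum>j\<in>UNIV. A $ i $ j * v $ j)"

lemma connected_induct:
  assumes "P i" and step: "\<And>i j. P i \<Longrightarrow> A $ i $ j > 0 \<Longrightarrow> P j"
  shows "P k"
proof -
  have "(i, k) \<in> (edge_rel A)\<^sup>*" using conn by (simp add: graph_connected_def)
  then show ?thesis
    by (induction rule: rtrancl_induct) (auto simp: edge_rel_def intro: assms)
qed

text \<open>A vertex without edges would be the only vertex by connectedness, and a graph without
  edges is bipartite.\<close>

lemma ex_edge: "\<exists>j. A $ i $ j > 0"
proof (rule ccontr)
  assume a: "\<not> ?thesis"
  have "k = i" for k
    by (rule connected_induct[of "\<lambda>k. k = i" i]) (use a in auto)
  then have "graph_bipartite A"
    unfolding graph_bipartite_def using a by metis
  with nonbip show False ..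
qed

lemma deg_pos: "deg A i > 0"
proof -
  obtain j where "A $ i $ j > 0" using ex_edge by blast
  then show ?thesis
    unfolding deg_def using nonneg by (intro sum_pos2[of _ j]) auto
qed

text \<open>By symmetry each edge exchanges the values of \<open>v\<close> and \<open>m\<close>. If
  they differed at every vertex, the sign of \<open>v - m\<close> would be a proper 2-colouring; so
  they agree somewhere, and connectedness spreads the common value.\<close>

lemma neighbour_const:
  assumes edge: "\<And>i j. A $ i $ j > 0 \<Longrightarrow> v j = m i"
  shows "\<exists>c. \<forall>i. v i = c \<and> m i = (c::real)"
proof -
  have swap: "v j = m i \<and> m j = v i" if "A $ i $ j > 0" for i j
    using edge[OF that] edge[of j i] that sym[of i j] by auto
  obtain i0 where i0: "v i0 = m i0"
  proof (rule ccontr)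
    assume "\<not> thesis"
    then have ne: "v i \<noteq> m i" for i using that by blast
    have "graph_bipartite A"
      unfolding graph_bipartite_def
      by (rule exI[of _ "\<lambda>i. v i < m i"]) (use swap ne in \<open>force\<close>)
    with nonbip show False ..
  qed
  have "v k = v i0 \<and> m k = v i0" for k
    by (rule connected_induct[of "\<lambda>k. v k = v i0 \<and> m k = v i0" i0])
       (use i0 swap in auto)
  then show ?thesis by blast
qed

lemma mu_eq: "mu A b i = adj i b / deg A i"
  by (simp add: mu_def)

lemma mu_vec_const: "(\<And>i. b $ i = c) \<Longrightarrow> mu A b i = c"
  using deg_pos[of i] by (simp add: mu_def deg_def sum_distrib_right[symmetric])

lemma adj_eq_mu: "adj i b = deg A i * mu A b i"
  using deg_pos[of i] by (simp add: mu_def)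

lemma mu_mono: "(\<And>j. b $ j \<le> b' $ j) \<Longrightarrow> mu A b i \<le> mu A b' i"
  unfolding mu_def using deg_pos[of i] nonneg
  by (intro divide_right_mono sum_mono mult_left_mono) auto

lemma mu_bounds:
  assumes "\<And>i. 0 \<le> b $ i \<and> b $ i \<le> 1"
  shows "0 \<le> mu A b i" "mu A b i \<le> 1"
  using mu_mono[of "vec 0" b i] mu_mono[of b "vec 1" i] mu_vec_const[of "vec 0" 0 i]
    mu_vec_const[of "vec 1" 1 i] assms by auto

lemma mu_pos:
  assumes "\<And>i. 0 < b $ i"
  shows "0 < mu A b i"
proof -
  obtain j where "A $ i $ j > 0" using ex_edge by blast
  then have "adj i b > 0"
    using nonneg assms by (intro sum_pos2[of _ j]) (auto simp: less_imp_le intro!: mult_nonneg_nonneg)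
  then show ?thesis using deg_pos[of i] by (simp add: mu_def)
qed

lemma adj_symmetric: "(\<Sum>i\<in>UNIV. u $ i * adj i v) = (\<Sum>i\<in>UNIV. v $ i * adj i u)"
proof -
  have "(\<Sum>i\<in>UNIV. u $ i * adj i v) = (\<Sum>i\<in>UNIV. \<Sum>j\<in>UNIV. A $ i $ j * u $ i * v $ j)"
    by (simp add: sum_distrib_left algebra_simps)
  also have "\<dots> = (\<Sum>j\<in>UNIV. \<Sum>i\<in>UNIV. A $ i $ j * u $ i * v $ j)"
    by (rule sum.swap)
  also have "\<dots> = (\<Sum>j\<in>UNIV. v $ j * adj j u)"
    by (subst sym) (simp add: sum_distrib_left algebra_simps)
  finally show ?thesis .
qed

text \<open>Jensen's inequality for \<open>1/s\<close>; the explicit remainder yields the equality case.\<close>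

lemma mu_inverse_remainder:
  assumes pos: "\<And>j. p $ j > 0"
  shows "mu A (\<chi> j. 1 / p $ j) i
    = 1 / mu A p i + (\<Sum>j\<in>UNIV. A $ i $ j * ((p $ j - mu A p i)\<^sup>2 / (p $ j * (mu A p i)\<^sup>2))) / deg A i"
proof -
  define m where "m = mu A p i"
  have m: "m > 0" unfolding m_def by (rule mu_pos) (use pos in simp)
  have d: "deg A i > 0" by (rule deg_pos)
  \<comment> \<open>Expansion of \<open>1 / q\<close> at \<open>m\<close> with exact remainder. The
    linear term disappears on averaging, since \<open>m\<close> is the mean of
    \<open>p\<close>.\<close>
  have e: "1 / q = 1/m - (q - m) / m\<^sup>2 + (q - m)\<^sup>2 / (q * m\<^sup>2)" if "q > 0" for q
    using m that by (simp add: field_simps power2_eq_square)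
  have "adj i (\<chi> j. 1 / p $ j)
     = (\<Sum>j\<in>UNIV. A$i$j * (2/m) - A $ i $ j * p $ j / m\<^sup>2 + A $ i $ j * ((p $ j - m)\<^sup>2 / (p $ j * m\<^sup>2)))"
  proof (rule sum.cong)
    fix j
    have "1 / p $ j = 2/m - p$j/m\<^sup>2 + (p$j - m)\<^sup>2 / (p$j * m\<^sup>2)"
      using m e[OF pos[of j]] by (simp add: diff_divide_distrib power2_eq_square)
    then show "A $ i $ j * (\<chi> j. 1 / p $ j) $ j = A$i$j * (2/m) - A $ i $ j * p $ j / m\<^sup>2 + A $ i $ j * ((p $ j - m)\<^sup>2 / (p $ j * m\<^sup>2))"
      by (simp only: vec_lambda_beta) (simp add: algebra_simps)
  qed simp
  also have "\<dots> = deg A i * (2/m) - adj i p / m\<^sup>2 + (\<Sum>j\<in>UNIV. A $ i $ j * ((p $ j - m)\<^sup>2 / (p $ j * m\<^sup>2)))"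
    by (simp add: sum.distrib sum_subtractf deg_def sum_distrib_right sum_divide_distrib)
  also have "adj i p = deg A i * m" by (simp add: adj_eq_mu m_def)
  finally show ?thesis
    using d m unfolding mu_eq[of "\<chi> j. 1 / p $ j"] m_def[symmetric]
    by (simp add: field_simps power2_eq_square)
qed

lemma mu_inverse_ge:
  assumes pos: "\<And>j. p $ j > 0"
  shows "mu A (\<chi> j. 1 / p $ j) i \<ge> 1 / mu A p i"
proof -
  have "(\<Sum>j\<in>UNIV. A $ i $ j * ((p $ j - mu A p i)\<^sup>2 / (p $ j * (mu A p i)\<^sup>2))) / deg A i \<ge> 0"
    using deg_pos[of i] nonneg pos less_imp_le[OF pos]
    by (intro divide_nonneg_pos sum_nonneg mult_nonneg_nonneg divide_nonneg_nonneg) auto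
  then show ?thesis by (simp add: mu_inverse_remainder[OF pos])
qed

text \<open>Equality makes each nonnegative term of the remainder vanish, so \<open>p\<close> equals
  the local mean along every edge and \<open>neighbour_const\<close> applies.\<close>

lemma mu_inverse_eq_const:
  assumes pos: "\<And>j. p $ j > 0"
    and eq: "\<And>i. mu A (\<chi> j. 1 / p $ j) i = 1 / mu A p i"
  shows "\<exists>c. \<forall>i. p $ i = c \<and> mu A p i = c"
proof (rule neighbour_const)
  fix i j assume ij: "A $ i $ j > 0"
  have m: "mu A p i > 0" by (rule mu_pos) (use pos in simp)
  have "(\<Sum>j\<in>UNIV. A $ i $ j * ((p $ j - mu A p i)\<^sup>2 / (p $ j * (mu A p i)\<^sup>2))) / deg A i = 0"
    using eq[of i] by (simp add: mu_inverse_remainder[OF pos])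
  then have "(\<Sum>j\<in>UNIV. A $ i $ j * ((p $ j - mu A p i)\<^sup>2 / (p $ j * (mu A p i)\<^sup>2))) = 0"
    using deg_pos[of i] by simp
  then have "A $ i $ j * ((p $ j - mu A p i)\<^sup>2 / (p $ j * (mu A p i)\<^sup>2)) = 0"
    using nonneg less_imp_le[OF pos]
    by (subst (asm) sum_nonneg_eq_0_iff) (auto intro!: mult_nonneg_nonneg divide_nonneg_nonneg)
  then show "p $ j = mu A p i" using ij m pos[of j] by auto
qed

section \<open>Rayleigh quotients and the Perron vector\<close>

definition wsum :: "real^'n \<Rightarrow> real^'n \<Rightarrow> real" where
  "wsum w v = (\<Sum>i\<in>UNIV. w $ i * (v $ i)\<^sup>2)"

definition qform :: "real^'n \<Rightarrow> real" where
  "qform v = (\<Sum>i\<in>UNIV. v $ i * adj i v)"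

lemma adj_add: "adj i (u + e *\<^sub>R z) = adj i u + e * adj i z"
  by (simp add: distrib_left sum.distrib sum_distrib_left mult.left_commute)

text \<open>By symmetry of \<open>A\<close> the two mixed terms coincide, so the first variation is
  twice a single sum.\<close>

lemma qform_add: "qform (u + e *\<^sub>R z) = qform u + 2 * e * (\<Sum>i\<in>UNIV. z $ i * adj i u) + e\<^sup>2 * qform z"
proof -
  have "qform (u + e *\<^sub>R z) = qform u + e * (\<Sum>i\<in>UNIV. u $ i * adj i z)
      + e * (\<Sum>i\<in>UNIV. z $ i * adj i u) + e\<^sup>2 * qform z"
  proof -
    define a b where "a i = adj i u" and "b i = adj i z" for i
    have "(u + e *\<^sub>R z) $ i * (a i + e * b i)
        = u $ i * a i + e * (u $ i * b i) + e * (z $ i * a i) + e\<^sup>2 * (z $ i * b i)" for i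
      by (simp add: algebra_simps power2_eq_square)
    then show ?thesis
      unfolding qform_def adj_add a_def[symmetric] b_def[symmetric]
      by (simp only: sum.distrib sum_distrib_left)
  qed
  then show ?thesis using adj_symmetric[of u z] by simp
qed

lemma wsum_add: "wsum w (u + e *\<^sub>R z)
   = wsum w u + 2 * e * (\<Sum>i\<in>UNIV. z $ i * (w $ i * u $ i)) + e\<^sup>2 * wsum w z"
  unfolding wsum_def sum_distrib_left sum.distrib[symmetric]
  by (intro sum.cong refl) (simp add: algebra_simps power2_eq_square)

lemma qform_scale: "qform (e *\<^sub>R z) = e\<^sup>2 * qform z"
  using qform_add[of 0 e z] by (simp add: qform_def)

lemma wsum_scale: "wsum w (e *\<^sub>R z) = e\<^sup>2 * wsum w z"
  using wsum_add[of w 0 e z] by (simp add: wsum_def)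

lemma wsum_pos:
  assumes "\<And>i. w $ i > 0" "v \<noteq> 0"
  shows "wsum w v > 0"
proof -
  obtain i where "v $ i \<noteq> 0" using assms(2) by (auto simp: vec_eq_iff)
  then show ?thesis unfolding wsum_def
    using assms(1) by (intro sum_pos2[of _ i]) (auto simp: less_imp_le)
qed

lemma wsum_nonneg: "(\<And>i. w $ i > 0) \<Longrightarrow> wsum w v \<ge> 0"
  unfolding wsum_def by (intro sum_nonneg mult_nonneg_nonneg) (auto simp: less_imp_le)

text \<open>A maximiser over the unit sphere exists by compactness. Taking absolute values leaves
  \<open>wsum\<close> unchanged and does not decrease \<open>qform\<close>, as the entries of
  \<open>A\<close> are nonnegative.\<close>

lemma rayleigh_max:
  assumes w: "\<And>i. w $ i > 0"
  shows "\<exists>l u. u \<noteq> 0 \<and> (\<forall>i. u $ i \<ge> 0) \<and> qform u = l * wsum w u \<and> (\<forall>v. qform v \<le> l * wsum w v)"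
proof -
  define S where "S = {v :: real^'n. norm v = 1}"
  have S: "compact S" using compact_sphere[of 0 1] by (simp add: S_def sphere_def)
  have "axis undefined 1 \<in> S" by (simp add: S_def)
  then have Sne: "S \<noteq> {}" by blast
  have cont: "continuous_on S (\<lambda>v. qform v / wsum w v)"
    unfolding qform_def wsum_def
  proof (intro continuous_intros ballI)
    fix v assume "v \<in> S"
    then have "v \<noteq> 0" by (auto simp: S_def)
    then show "(\<Sum>i\<in>UNIV. w $ i * (v $ i)\<^sup>2) \<noteq> 0" using wsum_pos[OF w, of v] by (simp add: wsum_def)
  qed
  obtain v0 where v0: "v0 \<in> S" and mx: "\<And>v. v \<in> S \<Longrightarrow> qform v / wsum w v \<le> qform v0 / wsum w v0"
    using continuous_attains_sup[OF S Sne cont] by blast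
  define l where "l = qform v0 / wsum w v0"
  have le: "qform v \<le> l * wsum w v" for v
  proof (cases "v = 0")
    case True then show ?thesis by (simp add: qform_def wsum_def)
  next
    case False
    then have "(1 / norm v) *\<^sub>R v \<in> S" by (simp add: S_def)
    from mx[OF this] have "qform v / wsum w v \<le> l"
      using False by (simp add: qform_scale wsum_scale l_def)
    then show ?thesis using wsum_pos[OF w False] by (simp add: field_simps)
  qed
  have v0n: "v0 \<noteq> 0" using v0 by (auto simp: S_def)
  define u where "u = (\<chi> i. \<bar>v0 $ i\<bar>)"
  have "qform v0 \<le> qform u"
    unfolding qform_def u_def
  proof (rule sum_mono)
    fix i
    have "v0 $ i * adj i v0 \<le> \<bar>v0 $ i\<bar> * \<bar>adj i v0\<bar>" by (metis abs_ge_self abs_mult)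
    also have "\<dots> \<le> \<bar>v0 $ i\<bar> * (\<Sum>j\<in>UNIV. \<bar>A $ i $ j * v0 $ j\<bar>)"
      by (intro mult_left_mono sum_abs) auto
    finally show "v0 $ i * adj i v0 \<le> (\<chi> i. \<bar>v0 $ i\<bar>) $ i * adj i (\<chi> i. \<bar>v0 $ i\<bar>)"
      using nonneg by (simp add: abs_mult)
  qed
  moreover have "wsum w u = wsum w v0" by (simp add: wsum_def u_def)
  moreover have "qform v0 = l * wsum w v0" using wsum_pos[OF w v0n] by (simp add: l_def)
  ultimately have "qform u = l * wsum w u" using le[of u] by simp
  moreover have "u \<noteq> 0" using v0n by (simp add: u_def vec_eq_iff)
  ultimately show ?thesis using le by (intro exI[of _ l] exI[of _ u]) (auto simp: u_def)
qed

text \<open>First-order condition for a maximum at \<open>e = 0\<close>.\<close>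

lemma quadratic_nonpos_imp_linear_zero:
  assumes "\<And>e::real. 2 * e * c + e\<^sup>2 * q \<le> 0"
  shows "c = 0"
proof (rule ccontr)
  assume c: "c \<noteq> 0"
  \<comment> \<open>Small enough that at \<open>e = k * c\<close> the linear term dominates the
    quadratic one.\<close>
  define k where "k = 1 / (1 + \<bar>q\<bar>)"
  have k: "k > 0" "k * \<bar>q\<bar> \<le> 1" by (auto simp: k_def field_simps add_pos_nonneg)
  have "2 * (k * c) * c + (k * c)\<^sup>2 * q = k * c\<^sup>2 * (2 + k * q)"
    by (simp add: power2_eq_square algebra_simps)
  moreover have "k * q \<ge> - 1"
  proof -
    have "- (k * q) \<le> k * \<bar>q\<bar>"
      using mult_left_mono[of "- q" "\<bar>q\<bar>" k] k by simp
    then show ?thesis using k by linarith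
  qed
  ultimately have "2 * (k * c) * c + (k * c)\<^sup>2 * q > 0" using k c by simp
  then show False using assms[of "k * c"] by simp
qed

lemma perron:
  assumes w: "\<And>i. w $ i > 0"
  obtains l u where "\<And>i. u $ i > 0" "\<And>i. adj i u = l * (w $ i * u $ i)"
    "\<And>v. qform v \<le> l * wsum w v"
proof -
  obtain l u where u0: "u \<noteq> 0" and un: "\<And>i. u $ i \<ge> 0" and eq: "qform u = l * wsum w u"
    and le: "\<And>v. qform v \<le> l * wsum w v"
    using rayleigh_max[OF w] by blast
  \<comment> \<open>Up to a factor 2 this is the gradient of \<open>qform - l * wsum w\<close> at
    \<open>u\<close>. It serves as direction of variation: the derivative in this direction, which
    is zero, is twice the sum of squares of \<open>z\<close>.\<close>
  define z where "z = (\<chi> i. adj i u - l * (w $ i * u $ i))"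
  have "(\<Sum>i\<in>UNIV. z $ i * adj i u) - l * (\<Sum>i\<in>UNIV. z $ i * (w $ i * u $ i)) = 0"
  proof (rule quadratic_nonpos_imp_linear_zero)
    fix e :: real
    show "2 * e * ((\<Sum>i\<in>UNIV. z $ i * adj i u) - l * (\<Sum>i\<in>UNIV. z $ i * (w $ i * u $ i)))
      + e\<^sup>2 * (qform z - l * wsum w z) \<le> 0"
      using le[of "u + e *\<^sub>R z"] eq by (simp add: qform_add wsum_add algebra_simps)
  qed
  moreover have "(\<Sum>i\<in>UNIV. z $ i * z $ i)
      = (\<Sum>i\<in>UNIV. z $ i * adj i u) - l * (\<Sum>i\<in>UNIV. z $ i * (w $ i * u $ i))"
  proof -
    have "z $ i * z $ i = z $ i * adj i u - l * (z $ i * (w $ i * u $ i))" for i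
    proof -
      have "z $ i * z $ i = z $ i * (adj i u - l * (w $ i * u $ i))"
        by (simp only: z_def vec_lambda_beta)
      then show ?thesis by (simp only: right_diff_distrib mult.left_commute)
    qed
    then show ?thesis by (simp only: sum_distrib_left[of l] sum_subtractf)
  qed
  ultimately have "(\<Sum>i\<in>UNIV. z $ i * z $ i) = 0" by simp
  then have "z $ i = 0" for i
    by (subst (asm) sum_nonneg_eq_0_iff) auto
  then have eig: "adj i u = l * (w $ i * u $ i)" for i
    by (simp add: z_def)
  \<comment> \<open>A zero of \<open>u\<close> forces zeros at all neighbours, since
    \<open>adj i u\<close> is then a vanishing sum of nonnegative terms.\<close>
  have "u $ k > 0" for k
  proof (rule ccontr)
    assume "\<not> u $ k > 0"
    then have k: "u $ k = 0" using un[of k] by simp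
    have "u $ m = 0" for m
    proof (rule connected_induct[of "\<lambda>i. u $ i = 0", OF k])
      fix i j assume i: "u $ i = 0" and a: "A $ i $ j > 0"
      have "adj i u = 0" using eig[of i] i by simp
      then have "A $ i $ j * u $ j = 0"
        using nonneg un by (subst (asm) sum_nonneg_eq_0_iff) auto
      then show "u $ j = 0" using a by simp
    qed
    then show False using u0 by (simp add: vec_eq_iff)
  qed
  then show thesis using that eig le by blast
qed

section \<open>Eigenvalues of the Jacobian\<close>

definition jweight :: "real^'n \<Rightarrow> real^'n" where
  "jweight gam = (\<chi> i. deg A i / gam $ i)"

text \<open>Multiplying row \<open>i\<close> of the eigenvalue equation by
  \<open>deg A i / gam $ i\<close> restores the symmetric matrix \<open>A\<close>; this is the
  origin of the weight \<open>jweight\<close>.\<close>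

lemma Jac_vec_0:
  assumes gam: "\<And>i. gam $ i > 0"
  shows "Jac A gam (vec 0) *v v = l *\<^sub>R v \<longleftrightarrow> (\<forall>i. adj i v = l * (jweight gam $ i * v $ i))"
proof -
  have diag: "(diagm d *v y) $ i = d $ i * y $ i" for d y :: "real^'n" and i
  proof -
    have "(diagm d *v y) $ i = (\<Sum>j\<in>UNIV. if i = j then d $ j * y $ j else 0)"
      unfolding diagm_def matrix_vector_mult_def vec_lambda_beta by (intro sum.cong) auto
    then show ?thesis by simp
  qed
  have "(Jac A gam (vec 0) *v v) $ i = gam $ i / deg A i * adj i v" for i
    unfolding Jac_def Wmat_def
    by (simp only: if_True simp_thms matrix_vector_mul_assoc[symmetric] diag)
       (simp add: matrix_vector_mult_def)
  moreover have "gam $ i / deg A i * adj i v = l * v $ i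
      \<longleftrightarrow> adj i v = l * (jweight gam $ i * v $ i)" for i
    using gam[of i] deg_pos[of i] by (auto simp: jweight_def field_simps)
  ultimately show ?thesis by (simp add: vec_eq_iff)
qed

text \<open>Eigenvectors of distinct eigenvalues are orthogonal for the weighted inner product,
  hence independent. Finiteness gives the \<open>Max\<close> in \<open>lambda_max\<close> its
  meaning.\<close>

lemma finite_generalised_eigenvalues:
  assumes w: "\<And>i. w $ i > 0"
  shows "finite {l. \<exists>v. v \<noteq> 0 \<and> (\<forall>i. adj i v = l * (w $ i * v $ i))}" (is "finite ?E")
proof -
  have "\<forall>l\<in>?E. \<exists>v. v \<noteq> 0 \<and> (\<forall>i. adj i v = l * (w $ i * v $ i))" by blast
  from bchoice[OF this] obtain f where
    "\<forall>l\<in>?E. f l \<noteq> 0 \<and> (\<forall>i. adj i (f l) = l * (w $ i * f l $ i))" ..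
  then have f: "\<And>l. l \<in> ?E \<Longrightarrow> f l \<noteq> 0"
    "\<And>l i. l \<in> ?E \<Longrightarrow> adj i (f l) = l * (w $ i * f l $ i)"
    by (simp_all only: Ball_def simp_thms)
  \<comment> \<open>Scaling by \<open>sqrt (w $ i)\<close> turns the weighted inner product into the
    Euclidean one.\<close>
  define g where "g l = (\<chi> i. sqrt (w $ i) * f l $ i)" for l
  have orth: "g l \<bullet> g m = 0" if "l \<in> ?E" "m \<in> ?E" "l \<noteq> m" for l m
  proof -
    have s: "sqrt (w $ i) * sqrt (w $ i) = w $ i" for i using w[of i] by simp
    have e: "g l \<bullet> g m = (\<Sum>i\<in>UNIV. w $ i * (f l $ i * f m $ i))"
      unfolding inner_vec_def g_def
    proof (intro sum.cong refl)
      fix i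
      have "(sqrt (w $ i) * f l $ i) * (sqrt (w $ i) * f m $ i)
          = (sqrt (w $ i) * sqrt (w $ i)) * (f l $ i * f m $ i)" by (simp only: mult_ac)
      then show "(\<chi> i. sqrt (w $ i) * f l $ i) $ i \<bullet> (\<chi> i. sqrt (w $ i) * f m $ i) $ i
          = w $ i * (f l $ i * f m $ i)"
        by (simp only: vec_lambda_beta inner_real_def s)
    qed
    have e1: "(\<Sum>i\<in>UNIV. f l $ i * adj i (f m)) = m * (g l \<bullet> g m)"
      unfolding f(2)[OF that(2)] e sum_distrib_left by (simp only: mult_ac)
    have e2: "(\<Sum>i\<in>UNIV. f m $ i * adj i (f l)) = l * (g l \<bullet> g m)"
      unfolding f(2)[OF that(1)] e sum_distrib_left by (simp only: mult_ac)
    have "m * (g l \<bullet> g m) = l * (g l \<bullet> g m)"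
      by (rule trans[OF e1[symmetric] trans[OF adj_symmetric e2]])
    then show ?thesis using that(3) by (auto simp only: mult_cancel_right)
  qed
  have nz: "g l \<noteq> 0" if "l \<in> ?E" for l
  proof
    assume "g l = 0"
    then have "sqrt (w $ i) * f l $ i = 0" for i
      by (simp only: g_def vec_eq_iff vec_lambda_beta zero_index)
    then have "f l $ i = 0" for i using w[of i] by (metis less_irrefl mult_eq_0_iff real_sqrt_eq_zero_cancel_iff)
    then show False using f(1)[OF that] by (simp only: vec_eq_iff zero_index simp_thms)
  qed
  have inj: "inj_on g ?E"
  proof (rule inj_onI, rule ccontr)
    fix l m assume lm: "l \<in> ?E" "m \<in> ?E" "g l = g m" "l \<noteq> m"
    then have "g m \<bullet> g m = 0" using orth[OF lm(1,2,4)] by (simp only:)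
    then show False using nz[OF lm(2)] by simp
  qed
  have "pairwise orthogonal (g ` ?E)"
  proof (rule pairwiseI)
    fix x y assume "x \<in> g ` ?E" "y \<in> g ` ?E" and ne: "x \<noteq> y"
    then obtain l m where lm: "l \<in> ?E" "m \<in> ?E" "x = g l" "y = g m" by (elim imageE)
    have "l \<noteq> m" using ne lm(3,4) by (intro notI) (simp only:)
    from orth[OF lm(1,2) this] show "orthogonal x y" unfolding lm(3,4) orthogonal_def .
  qed
  moreover have "0 \<notin> g ` ?E"
  proof
    assume "0 \<in> g ` ?E"
    then show False
    proof (rule imageE)
      fix l assume gl: "0 = g l" and l: "l \<in> ?E"
      from nz[OF l] gl[symmetric] show False by (rule notE)
    qed
  qed
  ultimately have "independent (g ` ?E)" by (rule pairwise_orthogonal_independent)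
  then have "finite (g ` ?E)" by (rule independent_imp_finite)
  then show ?thesis by (rule finite_imageD[OF _ inj])
qed

text \<open>An eigenvalue is the Rayleigh quotient of its eigenvector, so none exceeds
  \<open>l\<close>, and \<open>u\<close> attains it.\<close>

lemma lambda_max_Jac:
  assumes gam: "\<And>i. gam $ i > 0"
    and u: "\<And>i. u $ i > 0" "\<And>i. adj i u = l * (jweight gam $ i * u $ i)"
    and le: "\<And>v. qform v \<le> l * wsum (jweight gam) v"
  shows "lambda_max (Jac A gam (vec 0)) = l"
  unfolding lambda_max_def Jac_vec_0[OF gam]
proof (rule Max_eqI)
  have w: "jweight gam $ i > 0" for i using gam deg_pos by (simp add: jweight_def)
  show "finite {l. \<exists>v. v \<noteq> 0 \<and> (\<forall>i. adj i v = l * (jweight gam $ i * v $ i))}"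
    by (rule finite_generalised_eigenvalues[OF w])
  fix m assume "m \<in> {l. \<exists>v. v \<noteq> 0 \<and> (\<forall>i. adj i v = l * (jweight gam $ i * v $ i))}"
  then obtain v where v: "v \<noteq> 0" "\<And>i. adj i v = m * (jweight gam $ i * v $ i)" by blast
  have "qform v = m * wsum (jweight gam) v"
    unfolding qform_def wsum_def v(2) by (simp add: sum_distrib_left power2_eq_square algebra_simps)
  then show "m \<le> l" using le[of v] wsum_pos[OF w v(1)] by simp
next
  have "u \<noteq> 0" using u(1)[of undefined] by auto
  then show "l \<in> {l. \<exists>v. v \<noteq> 0 \<and> (\<forall>i. adj i v = l * (jweight gam $ i * v $ i))}"
    using u(2) by blast
qed

lemma perron_Jac:
  assumes gam: "\<And>i. gam $ i > 0"
  obtains u where "\<And>i. u $ i > 0"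
    "\<And>i. adj i u = lambda_max (Jac A gam (vec 0)) * (jweight gam $ i * u $ i)"
    "\<And>v. qform v \<le> lambda_max (Jac A gam (vec 0)) * wsum (jweight gam) v"
proof -
  have w: "jweight gam $ i > 0" for i using gam deg_pos by (simp add: jweight_def)
  obtain l u where u: "\<And>i. u $ i > 0" "\<And>i. adj i u = l * (jweight gam $ i * u $ i)"
    "\<And>v. qform v \<le> l * wsum (jweight gam) v"
    by (rule perron[OF w]) (rule that)
  note u' = u[folded lambda_max_Jac[OF gam u]]
  show thesis by (rule that) (rule u')+
qed

lemma qform_le_lambda_max:
  assumes gam: "\<And>i. gam $ i > 0"
  shows "qform v \<le> lambda_max (Jac A gam (vec 0)) * wsum (jweight gam) v"
  by (rule perron_Jac[OF gam])

text \<open>If \<open>u\<close> is the Perron vector at \<open>0\<close>, then \<open>1/u\<close> is a test vector at \<open>1\<close>.\<close>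

lemma lambda_max_inverse:
  assumes gam: "\<And>i. gam $ i > 0" and ne: "\<exists>i. gam $ i \<noteq> 1"
    and le1: "lambda_max (Jac A gam (vec 0)) \<le> 1"
  shows "lambda_max (Jac A (\<chi> i. 1 / gam $ i) (vec 0)) > 1"
proof (rule ccontr)
  define gam' where "gam' = (\<chi> i. 1 / gam $ i)"
  assume "\<not> ?thesis"
  then have le2: "lambda_max (Jac A gam' (vec 0)) \<le> 1" by (simp add: gam'_def)
  have gam': "gam' $ i > 0" for i using gam by (simp add: gam'_def)
  obtain u where u: "\<And>i. u $ i > 0"
    "\<And>i. adj i u = lambda_max (Jac A gam (vec 0)) * (jweight gam $ i * u $ i)"
    "\<And>v. qform v \<le> lambda_max (Jac A gam (vec 0)) * wsum (jweight gam) v"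
    by (rule perron_Jac[OF gam]) (rule that)
  note u' = qform_le_lambda_max[OF gam']
  define v where "v = (\<chi> i. 1 / u $ i)"
  have v: "v $ i > 0" for i using u(1) by (simp add: v_def)
  have w': "jweight gam' $ i > 0" for i using gam' deg_pos by (simp add: jweight_def)
  \<comment> \<open>The assumed bound at the other vertex, tested with \<open>v\<close>: on weighted
    average \<open>mu A v\<close> is at most \<open>gam / u\<close>.\<close>
  have "qform v \<le> 1 * wsum (jweight gam') v"
    using u'[of v] mult_right_mono[OF le2 wsum_nonneg[OF w', of v]] by linarith
  then have q: "qform v \<le> (\<Sum>i\<in>UNIV. deg A i * v $ i * (gam $ i / u $ i))"
    by (simp add: wsum_def jweight_def gam'_def v_def power2_eq_square algebra_simps)
  have mu_le: "mu A u i \<le> u $ i / gam $ i" for i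
  proof -
    have "jweight gam $ i * u $ i \<ge> 0"
      using deg_pos[of i] gam[of i] u(1)[of i] by (simp add: jweight_def)
    from mult_right_mono[OF le1 this] have "adj i u \<le> jweight gam $ i * u $ i"
      unfolding u(2) by simp
    then show ?thesis using deg_pos[of i] gam[of i] by (simp add: mu_eq jweight_def field_simps)
  qed
  have mu_u: "mu A u i > 0" for i by (rule mu_pos) (use u in simp)
  \<comment> \<open>Pointwise the reverse holds: the eigenvalue equation with eigenvalue at most
    \<open>1\<close> gives the first inequality, Jensen the second. Hence both are
    equalities.\<close>
  have a: "gam $ i / u $ i \<le> 1 / mu A u i" for i
    using mu_le[of i] mu_u[of i] gam[of i] u(1)[of i] by (simp add: field_simps)
  have b: "1 / mu A u i \<le> mu A v i" for i
    unfolding v_def by (rule mu_inverse_ge) (use u in simp)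
  have "qform v = (\<Sum>i\<in>UNIV. deg A i * v $ i * mu A v i)"
    unfolding qform_def adj_eq_mu by (simp only: mult_ac)
  with q have "(\<Sum>i\<in>UNIV. deg A i * v $ i * (mu A v i - gam $ i / u $ i)) \<le> 0"
    by (simp add: algebra_simps sum_subtractf)
  moreover have nn: "deg A i * v $ i * (mu A v i - gam $ i / u $ i) \<ge> 0" for i
    using deg_pos[of i] v[of i] a[of i] b[of i] by (intro mult_nonneg_nonneg) auto
  ultimately have "(\<Sum>i\<in>UNIV. deg A i * v $ i * (mu A v i - gam $ i / u $ i)) = 0"
    by (intro antisym sum_nonneg) auto
  then have "\<forall>i\<in>UNIV. deg A i * v $ i * (mu A v i - gam $ i / u $ i) = 0"
    using nn by (subst (asm) sum_nonneg_eq_0_iff) auto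
  then have "mu A v i = gam $ i / u $ i" for i
    using deg_pos[of i] v[of i] by force
  then have e: "mu A v i = 1 / mu A u i" "1 / mu A u i = gam $ i / u $ i" for i
    using a[of i] b[of i] by auto
  \<comment> \<open>Equality in Jensen's inequality makes \<open>u\<close> constant, and then every
    \<open>gam $ i\<close> is \<open>1\<close>.\<close>
  have "\<exists>c. \<forall>i. u $ i = c \<and> mu A u i = c"
    by (rule mu_inverse_eq_const) (use u e in \<open>auto simp: v_def\<close>)
  then obtain c where c: "\<And>i. u $ i = c" "\<And>i. mu A u i = c" by blast
  have "gam $ i = 1" for i
  proof -
    have "1 / c = gam $ i / c" using e(2)[of i] unfolding c by simp
    moreover have "c > 0" using u(1)[of i] unfolding c .
    ultimately show ?thesis by simp
  qed
  with ne show False by blast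
qed

text \<open>The odds vector \<open>u = b / (1 - b)\<close> of an interior fixed point satisfies
  \<open>\<Gamma> W u \<ge> u\<close> with strict inequality somewhere.\<close>

lemma no_interior_fixed_point:
  assumes gam: "\<And>i. gam $ i > 0" and ne: "\<exists>i. gam $ i \<noteq> 1"
    and le1: "lambda_max (Jac A gam (vec 0)) \<le> 1"
    and b: "\<And>i. 0 < b $ i \<and> b $ i < 1"
    and fix_b: "\<And>i. fbias (mu A b i) (gam $ i) = b $ i"
  shows False
proof -
  define p where "p = (\<chi> i. 1 - b $ i)"
  define u where "u = (\<chi> i. 1 / p $ i - 1)"
  have p: "p $ i > 0" for i using b[of i] by (simp add: p_def)
  have u: "u $ i > 0" for i using b[of i] by (simp add: u_def p_def)
  have mu_p: "mu A p i = 1 - mu A b i" for i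
    using deg_pos[of i] by (simp add: mu_def p_def deg_def diff_divide_distrib[symmetric]
        algebra_simps sum_subtractf) (simp add: diff_divide_distrib)
  have mu_b: "mu A b i > 0" for i by (rule mu_pos) (use b in simp)
  have mu_p_pos: "mu A p i > 0" for i by (rule mu_pos) (use p in simp)
  have mu_u: "mu A u i = mu A (\<chi> j. 1 / p $ j) i - 1" for i
    using deg_pos[of i] by (simp add: mu_def u_def deg_def diff_divide_distrib[symmetric]
        algebra_simps sum_subtractf) (simp add: diff_divide_distrib)
  \<comment> \<open>The fixed-point equation in odds: \<open>u $ i\<close> is \<open>gam $ i\<close>
    times the odds of \<open>mu A b i\<close>, which are \<open>1 / mu A p i - 1\<close>.\<close>
  have a: "u $ i / gam $ i = 1 / mu A p i - 1" for i
  proof -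
    define m where "m = mu A b i"
    have m: "0 < m" "m < 1" using mu_b[of i] mu_p_pos[of i] mu_p[of i] by (auto simp: m_def)
    have dpos: "1 + (gam $ i - 1) * m > 0"
      using m gam[of i] by (smt (verit) mult_minus_left mult_le_cancel_right2 mult_less_cancel_right2 left_diff_distrib mult_pos_pos)
    have "b $ i = gam $ i * m / (1 + (gam $ i - 1) * m)"
      using fix_b[of i] by (simp add: fbias_def m_def)
    then have "p $ i = (1 - m) / (1 + (gam $ i - 1) * m)"
      using dpos by (simp add: p_def field_simps)
    then have "u $ i = (1 + (gam $ i - 1) * m) / (1 - m) - 1"
      by (simp add: u_def)
    also have "\<dots> = gam $ i * m / (1 - m)"
      using m by (simp add: field_simps)
    finally have "u $ i = gam $ i * m / (1 - m)" .
    then show ?thesis using m gam[of i] by (simp add: mu_p m_def[symmetric] field_simps)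
  qed
  have ge: "mu A u i \<ge> u $ i / gam $ i" for i
    using mu_inverse_ge[OF p, of i] a[of i] mu_u[of i] by simp
  note u' = qform_le_lambda_max[OF gam, of u]
  have w: "jweight gam $ i > 0" for i using gam deg_pos by (simp add: jweight_def)
  \<comment> \<open>The Rayleigh bound gives the inequality opposite to \<open>ge\<close> after
    summation with the weights \<open>deg A i * u $ i\<close>, so equality holds at every
    vertex.\<close>
  have "qform u \<le> 1 * wsum (jweight gam) u"
    using u' mult_right_mono[OF le1 wsum_nonneg[OF w, of u]] by linarith
  moreover have "qform u = (\<Sum>i\<in>UNIV. deg A i * u $ i * mu A u i)"
    unfolding qform_def adj_eq_mu by (simp only: mult_ac)
  ultimately have "(\<Sum>i\<in>UNIV. deg A i * u $ i * (mu A u i - u $ i / gam $ i)) \<le> 0"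
    by (simp add: wsum_def jweight_def power2_eq_square algebra_simps sum_subtractf)
  moreover have nn: "deg A i * u $ i * (mu A u i - u $ i / gam $ i) \<ge> 0" for i
    using deg_pos[of i] u[of i] ge[of i] by (intro mult_nonneg_nonneg) auto
  ultimately have "(\<Sum>i\<in>UNIV. deg A i * u $ i * (mu A u i - u $ i / gam $ i)) = 0"
    by (intro antisym sum_nonneg) auto
  then have "\<forall>i\<in>UNIV. deg A i * u $ i * (mu A u i - u $ i / gam $ i) = 0"
    using nn by (subst (asm) sum_nonneg_eq_0_iff) auto
  then have "mu A u i = u $ i / gam $ i" for i
    using deg_pos[of i] u[of i] by force
  then have "mu A (\<chi> j. 1 / p $ j) i = 1 / mu A p i" for i
    using a[of i] mu_u[of i] by simp
  from mu_inverse_eq_const[OF p this]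
  obtain c where c: "\<And>i. p $ i = c" "\<And>i. mu A p i = c" by blast
  have "gam $ i = 1" for i
  proof -
    have "u $ i = 1 / c - 1" "u $ i / gam $ i = u $ i"
      using a[of i] c by (simp_all add: u_def)
    then show ?thesis using u[of i] gam[of i] by (simp add: field_simps)
  qed
  with ne show False by blast
qed

text \<open>Applied with \<open>e = 1\<close> to bound the Lyapunov function from below, and with
  \<open>e\<close> the step size to bound its second-order error.\<close>

lemma qform_bound:
  assumes "\<And>i. \<bar>v $ i\<bar> \<le> e"
  shows "\<bar>qform v\<bar> \<le> e\<^sup>2 * (\<Sum>i\<in>UNIV. deg A i)"
proof -
  have e: "e \<ge> 0" using assms[of undefined] by simp
  have "\<bar>qform v\<bar> \<le> (\<Sum>i\<in>UNIV. \<bar>v $ i * adj i v\<bar>)" unfolding qform_def by (rule sum_abs)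
  also have "\<dots> \<le> (\<Sum>i\<in>UNIV. e * (deg A i * e))"
  proof (rule sum_mono)
    fix i
    have "\<bar>adj i v\<bar> \<le> (\<Sum>j\<in>UNIV. \<bar>A $ i $ j * v $ j\<bar>)" by (rule sum_abs)
    also have "\<dots> \<le> (\<Sum>j\<in>UNIV. A $ i $ j * e)"
      using nonneg assms by (intro sum_mono) (simp add: abs_mult mult_left_mono)
    finally have "\<bar>adj i v\<bar> \<le> deg A i * e" by (simp add: deg_def sum_distrib_right)
    then show "\<bar>v $ i * adj i v\<bar> \<le> e * (deg A i * e)"
      unfolding abs_mult using assms e by (intro mult_mono) auto
  qed
  also have "\<dots> = e\<^sup>2 * (\<Sum>i\<in>UNIV. deg A i)"
    by (simp add: sum_distrib_left power2_eq_square mult_ac)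
  finally show ?thesis .
qed

text \<open>A coordinate equal to \<open>0\<close> forces the same at its neighbours, and likewise
  for \<open>1\<close>. So a fixed point that is not identically \<open>0\<close> or
  \<open>1\<close> is interior, which \<open>no_interior_fixed_point\<close> excludes.\<close>

lemma fixed_point_extreme:
  assumes gam: "\<And>i. gam $ i > 0" and ne: "\<exists>i. gam $ i \<noteq> 1"
    and le1: "lambda_max (Jac A gam (vec 0)) \<le> 1"
    and b: "\<And>i. 0 \<le> b $ i \<and> b $ i \<le> 1"
    and fix_b: "\<And>i. fbias (mu A b i) (gam $ i) = b $ i"
  shows "(\<forall>i. b $ i = 0) \<or> (\<forall>i. b $ i = 1)"
proof (rule ccontr)
  assume "\<not> ?thesis"
  then obtain i0 i1 where i0: "b $ i0 \<noteq> 0" and i1: "b $ i1 \<noteq> 1" by blast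
  have m: "0 \<le> mu A b i" "mu A b i \<le> 1" for i using mu_bounds[OF b] by auto
  have den: "1 + (gam $ i - 1) * mu A b i > 0" for i by (rule fbias_pos_den[OF m gam])
  have z: "b $ j = 0" if "b $ i = 0" "A $ i $ j > 0" for i j
  proof -
    have "mu A b i = 0"
      using fix_b[of i] that(1) den[of i] gam[of i] by (auto simp: fbias_def)
    then have "adj i b = 0" by (simp add: adj_eq_mu)
    then have "A $ i $ j * b $ j = 0"
      using nonneg b by (subst (asm) sum_nonneg_eq_0_iff) auto
    then show ?thesis using that(2) by simp
  qed
  have o: "b $ j = 1" if "b $ i = 1" "A $ i $ j > 0" for i j
  proof -
    have "mu A b i = 1"
      using fix_b[of i] that(1) den[of i] by (simp add: fbias_def field_simps)
    then have "(\<Sum>j\<in>UNIV. A $ i $ j * (1 - b $ j)) = 0"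
      by (simp add: right_diff_distrib sum_subtractf adj_eq_mu deg_def)
    then have "A $ i $ j * (1 - b $ j) = 0"
      using nonneg b by (subst (asm) sum_nonneg_eq_0_iff) auto
    then show ?thesis using that(2) by simp
  qed
  have "b $ i \<noteq> 0" for i
    using connected_induct[of "\<lambda>i. b $ i = 0" i i0] z i0 by blast
  moreover have "b $ i \<noteq> 1" for i
    using connected_induct[of "\<lambda>i. b $ i = 1" i i1] o i1 by blast
  ultimately have "0 < b $ i \<and> b $ i < 1" for i
    using b[of i] by (simp add: less_le)
  then show False using no_interior_fixed_point[OF gam ne le1 _ fix_b] by blast
qed

end

section \<open>Slowly moving sequences\<close>

text \<open>A sequence in the unit interval with steps \<open>1/(t+1)\<close> needs a fixed amount of the divergent
  series \<open>\<Sum> 1/(t+1)\<close> to cross a gap, so it cannot cross gaps infinitely often.\<close>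

lemma slow_sequence_leaves_middle:
  fixes y :: "nat \<Rightarrow> real"
  assumes step: "\<And>t. t \<ge> 1 \<Longrightarrow> \<bar>y (Suc t) - y t\<bar> \<le> 1 / (real t + 1)"
    and e: "e > 0"
    and bound: "\<And>T. (\<Sum>t\<in>{1..<T}. of_bool (e \<le> y t \<and> y t \<le> 1 - e) / (real t + 1)) \<le> B"
  shows "\<forall>\<^sub>F t in sequentially. y t < 2 * e \<or> y t > 1 - 2 * e"
proof -
  define g where "g t = (of_bool (t \<ge> 1 \<and> e \<le> y t \<and> y t \<le> 1 - e) :: real) / (real t + 1)" for t
  have g0: "g t \<ge> 0" for t by (simp add: g_def)
  have "(\<Sum>t<T. g t) \<le> B" for T
  proof -
    have "(\<Sum>t<T. g t) = (\<Sum>t\<in>{1..<T}. of_bool (e \<le> y t \<and> y t \<le> 1 - e) / (real t + 1))"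
      by (rule sum.mono_neutral_cong_right) (auto simp: g_def)
    then show ?thesis using bound[of T] by simp
  qed
  then have sg: "summable g" by (intro summableI_nonneg_bounded g0)
  then obtain N where N: "\<And>m n. m \<ge> N \<Longrightarrow> norm (\<Sum>t\<in>{m..<n}. g t) < e"
    using e unfolding summable_Cauchy by blast
  have "y n < 2 * e \<or> y n > 1 - 2 * e" if n: "n \<ge> max N 1" for n
  proof (rule ccontr)
    assume "\<not> ?thesis"
    then have yn: "2 * e \<le> y n" "y n \<le> 1 - 2 * e" by auto
    \<comment> \<open>As long as the sequence stays between \<open>e\<close> and
      \<open>1 - e\<close>, its displacement since time \<open>n\<close> is at most a block sum of
      \<open>g\<close>, hence less than \<open>e\<close>. Starting at distance at least
      \<open>2 * e\<close> from both ends, it never leaves.\<close>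
    have mid: "e \<le> y m \<and> y m \<le> 1 - e" if "m \<ge> n" for m
      using that
    proof (induction m rule: less_induct)
      case (less m)
      have "\<bar>y m - y n\<bar> \<le> (\<Sum>t\<in>{n..<m}. \<bar>y (Suc t) - y t\<bar>)"
        using sum_Suc_diff'[OF less.prems, of y] sum_abs[of "\<lambda>t. y (Suc t) - y t" "{n..<m}"] by simp
      also have "\<dots> \<le> (\<Sum>t\<in>{n..<m}. g t)"
        using less.IH n step by (intro sum_mono) (auto simp: g_def)
      also have "\<dots> < e" using N[of n m] n g0 by (simp add: sum_nonneg)
      finally show ?case using yn by (auto simp: abs_if split: if_splits)
    qed
    \<comment> \<open>From \<open>n\<close> on, \<open>g\<close> is the harmonic sequence.\<close>
    have "summable (\<lambda>t. g (t + n))" using sg by (subst summable_iff_shift)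
    then have "summable (\<lambda>t. 1 / (real (t + n) + 1))"
      using mid n by (simp add: g_def)
    then have "summable (\<lambda>t. inverse (real (Suc (t + n))))"
      by (simp add: inverse_eq_divide add_ac)
    then have "summable (\<lambda>t. inverse (real (Suc t)))"
      by (subst (asm) summable_iff_shift[of "\<lambda>t. inverse (real (Suc t))" n])
    then show False
      using not_summable_harmonic[where ?'a = real] by (subst (asm) summable_Suc_iff) simp
  qed
  then show ?thesis unfolding eventually_sequentially by blast
qed

text \<open>Eventually the sequence avoids a middle band too wide to be crossed in one step, so it
  stays on one side; there, letting \<open>e\<close> shrink gives the limit.\<close>

lemma slow_sequence_dichotomy:
  fixes y :: "nat \<Rightarrow> real"
  assumes range: "\<And>t. 0 \<le> y t \<and> y t \<le> 1"
    and step: "\<And>t. t \<ge> 1 \<Longrightarrow> \<bar>y (Suc t) - y t\<bar> \<le> 1 / (real t + 1)"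
    and bound: "\<And>e. e > 0 \<Longrightarrow> \<exists>B. \<forall>T. (\<Sum>t\<in>{1..<T}. of_bool (e \<le> y t \<and> y t \<le> 1 - e) / (real t + 1)) \<le> B"
  shows "y \<longlonglongrightarrow> 0 \<or> y \<longlonglongrightarrow> 1"
proof -
  have ev: "\<forall>\<^sub>F t in sequentially. y t < 2 * e \<or> y t > 1 - 2 * e" if "e > 0" for e
    using slow_sequence_leaves_middle[OF step that] bound[OF that] by blast
  obtain N where N: "\<And>t. t \<ge> N \<Longrightarrow> y t < 1/4 \<or> y t > 3/4"
    using ev[of "1/8"] by (auto simp: eventually_sequentially)
  define N' where "N' = max N 1"
  have st: "\<bar>y (Suc t) - y t\<bar> \<le> 1/2" if "t \<ge> N'" for t
  proof -
    have "1 / (real t + 1) \<le> 1/2" using that by (simp add: N'_def field_simps)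
    moreover have "\<bar>y (Suc t) - y t\<bar> \<le> 1 / (real t + 1)"
      using that by (intro step) (simp add: N'_def)
    ultimately show ?thesis by linarith
  qed
  have const: "(y t < 1/4) = (y N' < 1/4)" if "t \<ge> N'" for t
    using that
  proof (induction t rule: dec_induct)
    case (step t)
    have "y t < 1/4 \<or> y t > 3/4" "y (Suc t) < 1/4 \<or> y (Suc t) > 3/4"
      using N[of t] N[of "Suc t"] step by (auto simp: N'_def)
    then show ?case using st[of t] step by (auto simp: abs_if split: if_splits)
  qed simp
  show ?thesis
  proof (cases "y N' < 1/4")
    case True
    have "y \<longlonglongrightarrow> 0"
    proof (rule tendstoI)
      fix e :: real assume e: "e > 0"
      \<comment> \<open>The cap \<open>1/8\<close> makes the far alternative
        \<open>y t > 1 - 2 * e'\<close> incompatible with \<open>y t < 1/4\<close>.\<close>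
      define e' where "e' = min (e / 2) (1/8)"
      have "\<forall>\<^sub>F t in sequentially. y t < 2 * e' \<or> y t > 1 - 2 * e'"
        by (rule ev) (use e in \<open>simp add: e'_def\<close>)
      then show "\<forall>\<^sub>F t in sequentially. dist (y t) 0 < e"
        using eventually_ge_at_top[of N']
      proof eventually_elim
        case (elim t)
        then have "y t < 1/4" using const True by simp
        then show ?case using elim range[of t] by (auto simp: e'_def dist_real_def min_def split: if_splits)
      qed
    qed
    then show ?thesis ..
  next
    case False
    have "y \<longlonglongrightarrow> 1"
    proof (rule tendstoI)
      fix e :: real assume e: "e > 0"
      define e' where "e' = min (e / 2) (1/8)"
      have "\<forall>\<^sub>F t in sequentially. y t < 2 * e' \<or> y t > 1 - 2 * e'"
        by (rule ev) (use e in \<open>simp add: e'_def\<close>)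
      then show "\<forall>\<^sub>F t in sequentially. dist (y t) 1 < e"
        using eventually_ge_at_top[of N']
      proof eventually_elim
        case (elim t)
        then have "\<not> y t < 1/4" using const False by simp
        then show ?case using elim range[of t] by (auto simp: e'_def dist_real_def min_def split: if_splits)
      qed
    qed
    then show ?thesis ..
  qed
qed

section \<open>One-step expectations\<close>

lemma beta_cong:
  assumes "\<And>k. k \<in> {2..t} \<Longrightarrow> h k = h' k"
  shows "beta b1 h t = beta b1 h' t"
  using assms by (induction t) auto

text \<open>\<open>real t * beta\<close> is a running count in which the initial opinion has the
  weight of one declaration.\<close>

lemma real_beta_Suc:
  assumes "t \<ge> 1"
  shows "real (Suc t) * beta b1 h (Suc t) $ i = real t * beta b1 h t $ i + of_bool (h (Suc t) i)"
proof -
  have "beta b1 h (Suc t) $ i = real t / real (Suc t) * beta b1 h t $ i + of_bool (h (Suc t) i) / real (Suc t)"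
    using assms by simp
  then show ?thesis by (simp only: distrib_left) (simp del: of_nat_Suc beta.simps)
qed

lemma beta_Suc:
  assumes "t \<ge> 1"
  shows "beta b1 h (Suc t) $ i
     = beta b1 h t $ i + (of_bool (h (Suc t) i) - beta b1 h t $ i) / (real t + 1)"
proof -
  have "real t + 1 > 0" by simp
  then show ?thesis
    using real_beta_Suc[OF assms, of b1 h i] by (simp del: beta.simps add: field_simps)
qed

lemma beta_range:
  assumes "\<And>i. 0 < b1 $ i \<and> b1 $ i < 1"
  shows "0 < beta b1 h t $ i" "beta b1 h t $ i < 1"
proof (induction t)
  case (Suc t)
  have "0 < beta b1 h (Suc t) $ i \<and> beta b1 h (Suc t) $ i < 1"
  proof (cases "t = 0")
    case False
    then have a: "0 < real t * beta b1 h t $ i" "real t * beta b1 h t $ i < real t"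
      using Suc by simp_all
    have e: "real (Suc t) * beta b1 h (Suc t) $ i = real t * beta b1 h t $ i + of_bool (h (Suc t) i)"
      by (rule real_beta_Suc) (use False in simp)
    have "0 < real (Suc t) * beta b1 h (Suc t) $ i" "real (Suc t) * beta b1 h (Suc t) $ i < real (Suc t) * 1"
      unfolding e using a by (auto simp: of_bool_def)
    then show ?thesis
      by (simp only: zero_less_mult_iff mult_less_cancel_left) (auto simp del: beta.simps)
  qed (use assms in simp)
  then show "0 < beta b1 h (Suc t) $ i" "beta b1 h (Suc t) $ i < 1" by blast+
qed (use assms in auto)

text \<open>Marginal of a product law: giving the outcome \<open>False\<close> at \<open>i\<close>
  the factor \<open>0\<close> extends the sum to all \<open>s\<close>, where it factorises.\<close>

lemma sum_product_bernoulli: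
  fixes p :: "'n::finite \<Rightarrow> real"
  shows "(\<Sum>s\<in>{s. s i}. \<Prod>j\<in>UNIV. if s j then p j else 1 - p j) = p i"
proof -
  define q where "q j b = (if b then p j else if j = i then 0 else 1 - p j)" for j b
  have "(\<Sum>s\<in>{s. s i}. \<Prod>j\<in>UNIV. if s j then p j else 1 - p j)
     = (\<Sum>s\<in>UNIV. \<Prod>j\<in>UNIV. q j (s j))"
  proof (rule sum.mono_neutral_cong_left)
    show "\<forall>s\<in>UNIV - {s. s i}. (\<Prod>j\<in>UNIV. q j (s j)) = 0"
      by (auto simp: q_def intro!: prod_zero bexI[of _ i])
    fix s assume "s \<in> {s. s i}"
    then show "(\<Prod>j\<in>UNIV. if s j then p j else 1 - p j) = (\<Prod>j\<in>UNIV. q j (s j))"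
      by (intro prod.cong) (auto simp: q_def)
  qed auto
  also have "\<dots> = (\<Prod>j\<in>UNIV. \<Sum>b\<in>UNIV. q j b)"
    using prod_sum_PiE[of "UNIV :: 'n set" "\<lambda>_. UNIV :: bool set" q] by (simp add: PiE_UNIV_domain)
  also have "\<dots> = (\<Prod>j\<in>UNIV. if j = i then p j else 1)"
    by (intro prod.cong) (auto simp: q_def UNIV_bool)
  also have "\<dots> = p i" by simp
  finally show ?thesis .
qed

text \<open>Measurability with respect to the history at time \<open>t\<close>, expressed without a
  filtration; declarations start at time \<open>2\<close>.\<close>

definition adapted :: "nat \<Rightarrow> ((nat \<Rightarrow> 'n \<Rightarrow> bool) \<Rightarrow> 'b) \<Rightarrow> bool" where
  "adapted t g \<longleftrightarrow> (\<forall>h h'. (\<forall>k\<in>{2..t}. h k = h' k) \<longrightarrow> g h = g h')"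

lemma adaptedD: "adapted t g \<Longrightarrow> (\<And>k. k \<in> {2..t} \<Longrightarrow> h k = h' k) \<Longrightarrow> g h = g h'"
  by (auto simp: adapted_def)

lemma adapted_beta: "s \<le> t \<Longrightarrow> adapted t (\<lambda>h. beta b1 h s)"
  unfolding adapted_def by (auto intro!: beta_cong)

lemma adapted_const: "adapted t (\<lambda>h. c)"
  by (simp add: adapted_def)

lemma adapted_comp: "adapted t g \<Longrightarrow> adapted t (\<lambda>h. f (g h))"
  unfolding adapted_def by metis

lemma adapted_comp2: "adapted t g \<Longrightarrow> adapted t g' \<Longrightarrow> adapted t (\<lambda>h. f (g h) (g' h))"
  unfolding adapted_def by metis

lemma adapted_mono: "adapted s g \<Longrightarrow> s \<le> t \<Longrightarrow> adapted t g"
  unfolding adapted_def by (meson atLeastAtMost_iff le_trans)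

text \<open>By Fatou's lemma the \<open>liminf\<close> has expectation at most \<open>B\<close> and
  is therefore almost surely finite.\<close>

lemma (in prob_space) AE_not_at_top_of_bounded_expectation:
  fixes Z :: "nat \<Rightarrow> 'a \<Rightarrow> real"
  assumes int: "\<And>t. t \<ge> s \<Longrightarrow> integrable M (Z t)"
    and nn: "\<And>t \<omega>. t \<ge> s \<Longrightarrow> Z t \<omega> \<ge> 0"
    and bound: "\<And>t. t \<ge> s \<Longrightarrow> expectation (Z t) \<le> B"
  shows "AE \<omega> in M. \<not> filterlim (\<lambda>t. Z t \<omega>) at_top sequentially"
proof -
  define Y where "Y t = Z (t + s)" for t
  have int: "integrable M (Y t)" for t using int by (simp add: Y_def)
  have nn: "Y t \<omega> \<ge> 0" for t \<omega> using nn by (simp add: Y_def)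
  have meas: "(\<lambda>\<omega>. ennreal (Y t \<omega>)) \<in> borel_measurable M" for t
    using int[of t] by measurable
  have "(\<integral>\<^sup>+\<omega>. liminf (\<lambda>t. ennreal (Y t \<omega>)) \<partial>M) \<le> liminf (\<lambda>t. \<integral>\<^sup>+\<omega>. ennreal (Y t \<omega>) \<partial>M)"
    by (rule nn_integral_liminf) (rule meas)
  also have "\<dots> \<le> ennreal B"
  proof (rule Liminf_le)
    show "\<forall>\<^sub>F t in sequentially. (\<integral>\<^sup>+\<omega>. ennreal (Y t \<omega>) \<partial>M) \<le> ennreal B"
      using bound int nn
      by (intro always_eventually allI) (subst nn_integral_eq_integral, auto simp: Y_def intro!: ennreal_leI)
  qed simp
  finally have "(\<integral>\<^sup>+\<omega>. liminf (\<lambda>t. ennreal (Y t \<omega>)) \<partial>M) \<noteq> \<infinity>"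
    by (auto simp: top_unique)
  then have "AE \<omega> in M. liminf (\<lambda>t. ennreal (Y t \<omega>)) \<noteq> \<infinity>"
    by (intro nn_integral_noteq_infinite) (auto intro!: borel_measurable_liminf meas)
  then show ?thesis
  proof (rule AE_mp, intro AE_I2 impI notI)
    fix \<omega> assume a: "liminf (\<lambda>t. ennreal (Y t \<omega>)) \<noteq> \<infinity>"
      and "filterlim (\<lambda>t. Z t \<omega>) at_top sequentially"
    then have "filterlim (\<lambda>t. Y t \<omega>) at_top sequentially"
      unfolding Y_def using filterlim_compose[OF _ filterlim_add_const_nat_at_top, of "\<lambda>t. Z t \<omega>"] by blast
    then have "(\<lambda>t. ennreal (Y t \<omega>)) \<longlonglongrightarrow> \<infinity>"
      by (simp add: ennreal_tendsto_top_eq_at_top)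
    then have "liminf (\<lambda>t. ennreal (Y t \<omega>)) = \<infinity>"
      by (rule lim_imp_Liminf[rotated]) simp
    with a show False ..
  qed
qed

section \<open>Conditional expectations along the declaration process\<close>

locale opinion_process = opinion_graph A + prob_space M
  for A :: "real^'n^'n" and M :: "'a measure" +
  fixes gam b1 :: "real^'n" and Psi :: "nat \<Rightarrow> 'a \<Rightarrow> 'n \<Rightarrow> bool"
  assumes gam_pos: "gam $ i > 0"
    and init: "0 < b1 $ i \<and> b1 $ i < 1"
    and meas: "(\<lambda>\<omega>. Psi t \<omega> i) \<in> M \<rightarrow>\<^sub>M count_space UNIV"
    and dyn: "t \<ge> 1 \<Longrightarrow>
       measure M {\<omega> \<in> space M. (\<forall>k\<in>{2..t}. Psi k \<omega> = h k) \<and> Psi (Suc t) \<omega> = s}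
       = measure M {\<omega> \<in> space M. \<forall>k\<in>{2..t}. Psi k \<omega> = h k}
         * (\<Prod>i\<in>UNIV. let p = fbias (mu A (beta b1 h t) i) (gam $ i)
                        in if s i then p else 1 - p)"
begin

abbreviation decl :: "'a \<Rightarrow> nat \<Rightarrow> 'n \<Rightarrow> bool" where
  "decl \<omega> \<equiv> (\<lambda>k. Psi k \<omega>)"

abbreviation bt :: "(nat \<Rightarrow> 'n \<Rightarrow> bool) \<Rightarrow> nat \<Rightarrow> real^'n" where
  "bt h t \<equiv> beta b1 h t"

definition rate :: "real^'n \<Rightarrow> 'n \<Rightarrow> real" where
  "rate b i = fbias (mu A b i) (gam $ i)"

definition cylinder :: "nat \<Rightarrow> (nat \<Rightarrow> 'n \<Rightarrow> bool) \<Rightarrow> 'a set" where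
  "cylinder t h = {\<omega> \<in> space M. \<forall>k\<in>{2..t}. Psi k \<omega> = h k}"

text \<open>Extensional functions give exactly one representative per history, and finitely many in
  all.\<close>

definition histories :: "nat \<Rightarrow> (nat \<Rightarrow> 'n \<Rightarrow> bool) set" where
  "histories t = {2..t} \<rightarrow>\<^sub>E UNIV"

lemma finite_histories: "finite (histories t)"
  unfolding histories_def by (rule finite_PiE) auto

lemma pred_Psi_eq [measurable]: "Measurable.pred M (\<lambda>\<omega>. Psi k \<omega> = s)"
proof -
  have [measurable]: "Measurable.pred M (\<lambda>\<omega>. Psi k \<omega> i)" for i using meas[of k i] by simp
  show ?thesis unfolding fun_eq_iff by measurable
qed

lemma pred_Psi [measurable]: "Measurable.pred M (\<lambda>\<omega>. Psi k \<omega> i)"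
  using meas[of k i] by simp

lemma cylinder_sets [measurable]: "cylinder t h \<in> events"
  unfolding cylinder_def by measurable

lemma cylinder_Int_space [simp]: "cylinder t h \<inter> space M = cylinder t h"
  by (auto simp: cylinder_def)

text \<open>The cylinders of the finitely many histories partition the space and \<open>g\<close> is
  constant on each, so \<open>g\<close> is a simple function; integrability and expectations follow
  from this.\<close>

lemma adapted_expansion:
  assumes "adapted t g" "\<omega> \<in> space M"
  shows "g (decl \<omega>) = (\<Sum>h\<in>histories t. g h * indicat_real (cylinder t h) \<omega>)"
proof -
  define h0 where "h0 = restrict (decl \<omega>) {2..t}"
  have h0: "h0 \<in> histories t" by (auto simp: h0_def histories_def)
  have "\<omega> \<in> cylinder t h \<longleftrightarrow> h = h0" if "h \<in> histories t" for h
    using that assms(2) by (auto simp: cylinder_def h0_def histories_def PiE_iff extensional_def fun_eq_iff restrict_def)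
  then have "(\<Sum>h\<in>histories t. g h * indicat_real (cylinder t h) \<omega>)
      = (\<Sum>h\<in>histories t. if h = h0 then g h else 0)"
    by (intro sum.cong) (auto simp: indicator_def)
  also have "\<dots> = g h0" using h0 finite_histories by simp
  also have "\<dots> = g (decl \<omega>)"
    by (rule adaptedD[OF assms(1)]) (auto simp: h0_def)
  finally show ?thesis ..
qed

lemma integrable_adapted_mult:
  assumes g: "adapted t (g :: _ \<Rightarrow> real)" and E: "E \<in> events"
  shows "integrable M (\<lambda>\<omega>. g (decl \<omega>) * indicat_real E \<omega>)"
    and "expectation (\<lambda>\<omega>. g (decl \<omega>) * indicat_real E \<omega>)
       = (\<Sum>h\<in>histories t. g h * prob (cylinder t h \<inter> E))"
proof -
  have i: "integrable M (\<lambda>\<omega>. g h * indicat_real (cylinder t h \<inter> E) \<omega>)" for h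
    using E by (intro integrable_mult_right integrable_real_indicator) (auto simp: emeasure_eq_measure)
  have e: "g (decl \<omega>) * indicat_real E \<omega>
    = (\<Sum>h\<in>histories t. g h * indicat_real (cylinder t h \<inter> E) \<omega>)" if "\<omega> \<in> space M" for \<omega>
    unfolding adapted_expansion[OF g that]
    by (simp add: sum_distrib_right indicator_inter_arith mult.assoc)
  show "integrable M (\<lambda>\<omega>. g (decl \<omega>) * indicat_real E \<omega>)"
    by (subst Bochner_Integration.integrable_cong[OF refl e]) (auto intro: i)
  have "expectation (\<lambda>\<omega>. g (decl \<omega>) * indicat_real E \<omega>)
     = expectation (\<lambda>\<omega>. \<Sum>h\<in>histories t. g h * indicat_real (cylinder t h \<inter> E) \<omega>)"
    by (rule Bochner_Integration.integral_cong[OF refl e])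
  also have "\<dots> = (\<Sum>h\<in>histories t. g h * prob (cylinder t h \<inter> E))"
    by (subst Bochner_Integration.integral_sum[OF i]) (use E in simp)
  finally show "expectation (\<lambda>\<omega>. g (decl \<omega>) * indicat_real E \<omega>)
       = (\<Sum>h\<in>histories t. g h * prob (cylinder t h \<inter> E))" .
qed

lemma integrable_adapted:
  assumes "adapted t (g :: _ \<Rightarrow> real)"
  shows "integrable M (\<lambda>\<omega>. g (decl \<omega>))"
proof -
  have "integrable M (\<lambda>\<omega>. g (decl \<omega>) * indicat_real (space M) \<omega>)"
    by (rule integrable_adapted_mult[OF assms]) simp
  then show ?thesis
    by (rule Bochner_Integration.integrable_cong[THEN iffD1, rotated 2]) auto
qed

lemma integrable_adapted_Psi:
  assumes "adapted t (g :: _ \<Rightarrow> real)"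
  shows "integrable M (\<lambda>\<omega>. g (decl \<omega>) * of_bool (Psi (Suc t) \<omega> i))"
proof -
  have "integrable M (\<lambda>\<omega>. g (decl \<omega>) * indicat_real {\<omega> \<in> space M. Psi (Suc t) \<omega> i} \<omega>)"
    by (rule integrable_adapted_mult[OF assms]) measurable
  then show ?thesis
    by (rule Bochner_Integration.integrable_cong[THEN iffD1, rotated 2]) (auto simp: indicator_def)
qed

text \<open>The joint law is summed over all outcomes with \<open>s i\<close>. The product form
  avoids dividing by the probability of the cylinder, which may vanish.\<close>

lemma prob_cylinder_Psi:
  assumes "t \<ge> 1"
  shows "prob (cylinder t h \<inter> {\<omega> \<in> space M. Psi (Suc t) \<omega> i}) = prob (cylinder t h) * rate (bt h t) i"
proof -
  have eq: "cylinder t h \<inter> {\<omega> \<in> space M. Psi (Suc t) \<omega> i}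
     = (\<Union>s\<in>{s. s i}. {\<omega> \<in> space M. (\<forall>k\<in>{2..t}. Psi k \<omega> = h k) \<and> Psi (Suc t) \<omega> = s})"
    by (auto simp: cylinder_def)
  have "prob (cylinder t h \<inter> {\<omega> \<in> space M. Psi (Suc t) \<omega> i})
     = (\<Sum>s\<in>{s. s i}. prob {\<omega> \<in> space M. (\<forall>k\<in>{2..t}. Psi k \<omega> = h k) \<and> Psi (Suc t) \<omega> = s})"
    unfolding eq
  proof (rule finite_measure_finite_Union)
    show "disjoint_family_on (\<lambda>s. {\<omega> \<in> space M. (\<forall>k\<in>{2..t}. Psi k \<omega> = h k) \<and> Psi (Suc t) \<omega> = s}) {s. s i}"
      by (auto simp: disjoint_family_on_def)
  qed auto
  also have "\<dots> = prob (cylinder t h) * (\<Sum>s\<in>{s. s i}. \<Prod>j\<in>UNIV. if s j then rate (bt h t) j else 1 - rate (bt h t) j)"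
    unfolding sum_distrib_left rate_def dyn[OF assms] cylinder_def Let_def ..
  finally show ?thesis by (simp add: sum_product_bernoulli)
qed

text \<open>The tower property: given the history, the declaration may be replaced by its
  conditional probability. It is checked cylinder by cylinder.\<close>

lemma expectation_adapted_Psi:
  assumes g: "adapted t (g :: _ \<Rightarrow> real)" and t: "t \<ge> 1"
  shows "expectation (\<lambda>\<omega>. g (decl \<omega>) * of_bool (Psi (Suc t) \<omega> i))
       = expectation (\<lambda>\<omega>. g (decl \<omega>) * rate (bt (decl \<omega>) t) i)"
proof -
  have gr: "adapted t (\<lambda>h. g h * rate (bt h t) i)"
    using adapted_comp2[OF g adapted_beta[OF order_refl], of "\<lambda>x b. x * rate b i"] by simp
  have "expectation (\<lambda>\<omega>. g (decl \<omega>) * of_bool (Psi (Suc t) \<omega> i))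
      = expectation (\<lambda>\<omega>. g (decl \<omega>) * indicat_real {\<omega> \<in> space M. Psi (Suc t) \<omega> i} \<omega>)"
    by (rule Bochner_Integration.integral_cong) (auto simp: indicator_def)
  also have "\<dots> = (\<Sum>h\<in>histories t. g h * prob (cylinder t h \<inter> {\<omega> \<in> space M. Psi (Suc t) \<omega> i}))"
    by (rule integrable_adapted_mult[OF g]) measurable
  also have "\<dots> = (\<Sum>h\<in>histories t. (g h * rate (bt h t) i) * prob (cylinder t h \<inter> space M))"
    by (intro sum.cong refl) (simp add: prob_cylinder_Psi[OF t])
  also have "\<dots> = expectation (\<lambda>\<omega>. g (decl \<omega>) * rate (bt (decl \<omega>) t) i * indicat_real (space M) \<omega>)"
    by (rule integrable_adapted_mult(2)[OF gr, symmetric]) simp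
  also have "\<dots> = expectation (\<lambda>\<omega>. g (decl \<omega>) * rate (bt (decl \<omega>) t) i)"
    by (rule Bochner_Integration.integral_cong) auto
  finally show ?thesis .
qed

text \<open>If \<open>F\<close> is bounded by an expression affine in the new declarations with
  adapted coefficients, then in expectation each declaration may be replaced by its rate. Both the
  supermartingale bounds and the Lyapunov descent rest on this.\<close>

lemma expectation_step_le:
  fixes F G a :: "(nat \<Rightarrow> 'n \<Rightarrow> bool) \<Rightarrow> real"
  assumes t: "t \<ge> 1" and F: "adapted (Suc t) F" and G: "adapted t G" and a: "adapted t a"
    and c: "\<And>i. adapted t (c i)"
    and le1: "\<And>h. F h \<le> a h + (\<Sum>i\<in>UNIV. c i h * of_bool (h (Suc t) i))"
    and le2: "\<And>h. a h + (\<Sum>i\<in>UNIV. c i h * rate (bt h t) i) \<le> G h"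
  shows "expectation (\<lambda>\<omega>. F (decl \<omega>)) \<le> expectation (\<lambda>\<omega>. G (decl \<omega>))"
proof -
  have cr: "adapted t (\<lambda>h. c i h * rate (bt h t) i)" for i
    using adapted_comp2[OF c adapted_beta[OF order_refl], of "\<lambda>x b. x * rate b i"] by simp
  note int = integrable_adapted[OF a] integrable_adapted_Psi[OF c] integrable_adapted[OF cr]
  have "expectation (\<lambda>\<omega>. F (decl \<omega>))
     \<le> expectation (\<lambda>\<omega>. a (decl \<omega>) + (\<Sum>i\<in>UNIV. c i (decl \<omega>) * of_bool (Psi (Suc t) \<omega> i)))"
    by (intro integral_mono Bochner_Integration.integrable_add Bochner_Integration.integrable_sum int integrable_adapted[OF F] le1)
  also have "\<dots> = expectation (\<lambda>\<omega>. a (decl \<omega>))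
      + (\<Sum>i\<in>UNIV. expectation (\<lambda>\<omega>. c i (decl \<omega>) * of_bool (Psi (Suc t) \<omega> i)))"
    by (subst Bochner_Integration.integral_add Bochner_Integration.integral_sum;
        (intro Bochner_Integration.integrable_sum int)?)+ simp
  also have "\<dots> = expectation (\<lambda>\<omega>. a (decl \<omega>))
      + (\<Sum>i\<in>UNIV. expectation (\<lambda>\<omega>. c i (decl \<omega>) * rate (bt (decl \<omega>) t) i))"
    by (simp add: expectation_adapted_Psi[OF c t])
  also have "\<dots> = expectation (\<lambda>\<omega>. a (decl \<omega>) + (\<Sum>i\<in>UNIV. c i (decl \<omega>) * rate (bt (decl \<omega>) t) i))"
    by (subst Bochner_Integration.integral_add Bochner_Integration.integral_sum;
        (intro Bochner_Integration.integrable_sum int)?)+ simp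
  also have "\<dots> \<le> expectation (\<lambda>\<omega>. G (decl \<omega>))"
    by (intro integral_mono Bochner_Integration.integrable_add Bochner_Integration.integrable_sum int integrable_adapted[OF G] le2)
  finally show ?thesis .
qed

section \<open>Instability\<close>

lemma bt_range: "0 < bt h t $ i" "bt h t $ i < 1"
  using beta_range[of b1 h t i] init by blast+

lemma mu_bt_range: "0 \<le> mu A (bt h t) i" "mu A (bt h t) i \<le> 1"
  by (rule mu_bounds; use bt_range in \<open>auto simp: less_imp_le\<close>)+

text \<open>The weights \<open>jweight gam $ i * u $ i\<close> form a left eigenvector of
  \<open>\<Gamma> W\<close>, so the linearised drift is exactly \<open>l\<close> times the weighted
  opinion; the denominator of \<open>fbias\<close> costs at most the factor
  \<open>1 + r\<close>.\<close>

lemma perron_drift: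
  assumes u: "\<And>i. u $ i > 0" "\<And>i. adj i u = l * (jweight gam $ i * u $ i)"
    and r: "\<And>i. (gam $ i - 1) * mu A (bt h t) i \<le> r"
  shows "l / (1 + r) * (\<Sum>i\<in>UNIV. jweight gam $ i * u $ i * bt h t $ i)
    \<le> (\<Sum>i\<in>UNIV. jweight gam $ i * u $ i * rate (bt h t) i)"
proof -
  define b where "b = bt h t"
  have "l * (\<Sum>i\<in>UNIV. jweight gam $ i * u $ i * b $ i) = (\<Sum>i\<in>UNIV. b $ i * adj i u)"
    unfolding u(2) sum_distrib_left by (simp only: mult_ac)
  also have "\<dots> = (\<Sum>i\<in>UNIV. u $ i * adj i b)" by (rule adj_symmetric)
  also have "\<dots> = (\<Sum>i\<in>UNIV. jweight gam $ i * u $ i * (gam $ i * mu A b i))"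
    unfolding adj_eq_mu using gam_pos
    by (intro sum.cong refl) (simp add: jweight_def less_imp_neq[symmetric])
  finally have "l / (1 + r) * (\<Sum>i\<in>UNIV. jweight gam $ i * u $ i * b $ i)
     = (\<Sum>i\<in>UNIV. jweight gam $ i * u $ i * (gam $ i * mu A b i)) / (1 + r)"
    by simp
  also have "\<dots> = (\<Sum>i\<in>UNIV. jweight gam $ i * u $ i * (gam $ i * mu A b i / (1 + r)))"
    by (simp add: sum_divide_distrib)
  also have "\<dots> \<le> (\<Sum>i\<in>UNIV. jweight gam $ i * u $ i * rate b i)"
  proof (intro sum_mono mult_left_mono)
    fix i
    have m: "0 \<le> mu A b i" "mu A b i \<le> 1" unfolding b_def by (rule mu_bt_range)+
    have d: "1 + (gam $ i - 1) * mu A b i > 0" by (rule fbias_pos_den[OF m gam_pos])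
    show "gam $ i * mu A b i / (1 + r) \<le> rate b i"
      unfolding rate_def fbias_def
      using d r[of i] m gam_pos[of i] by (intro divide_left_mono) (auto simp: b_def)
    show "0 \<le> jweight gam $ i * u $ i"
      using gam_pos[of i] deg_pos[of i] u(1)[of i] by (simp add: jweight_def)
  qed
  finally show ?thesis unfolding b_def .
qed

text \<open>The upper bound is affine in \<open>d\<close>, hence its expectation depends only on the expectation of \<open>d\<close>.\<close>

lemma one_over_add_le:
  assumes "0 < (x::real)" "0 \<le> d" "d \<le> C"
  shows "1 / (x + d) \<le> 1 / x - d / (x * (x + C))"
proof -
  have "1 / (x + d) = 1 / x - d / (x * (x + d))"
    using assms diff_frac_eq[of x "x + d" 1 1] by simp
  moreover have "d / (x * (x + C)) \<le> d / (x * (x + d))"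
    using assms by (intro divide_left_mono mult_left_mono) auto
  ultimately show ?thesis by simp
qed

section \<open>Weighted declaration counts\<close>

context
  fixes c :: "'n \<Rightarrow> real"
  assumes c_pos: "c i > 0"
begin

definition mass :: "nat \<Rightarrow> (nat \<Rightarrow> 'n \<Rightarrow> bool) \<Rightarrow> real" where
  "mass t h = (\<Sum>i\<in>UNIV. c i * (real t * bt h t $ i))"

definition total :: real where "total = (\<Sum>i\<in>UNIV. c i)"

lemma total_pos: "total > 0"
  unfolding total_def by (intro sum_pos c_pos) auto

lemma mass_eq: "mass t h = real t * (\<Sum>i\<in>UNIV. c i * bt h t $ i)"
  unfolding mass_def sum_distrib_left by (simp only: mult_ac)

lemma mass_Suc: "t \<ge> 1 \<Longrightarrow> mass (Suc t) h = mass t h + (\<Sum>i\<in>UNIV. c i * of_bool (h (Suc t) i))"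
  unfolding mass_def by (simp only: real_beta_Suc distrib_left sum.distrib)

lemma increment_bounds:
  "0 \<le> (\<Sum>i\<in>UNIV. c i * of_bool (h (Suc t) i))" "(\<Sum>i\<in>UNIV. c i * of_bool (h (Suc t) i)) \<le> total"
  unfolding total_def by (auto intro!: sum_nonneg sum_mono less_imp_le[OF c_pos] simp: of_bool_def)

lemma mass_mono:
  assumes "1 \<le> s" "s \<le> t"
  shows "mass s h \<le> mass t h"
  using assms(2)
proof (induction t rule: dec_induct)
  case (step n)
  then show ?case using mass_Suc[of n h] assms(1) increment_bounds(1)[of h n] by simp
qed simp_all

lemma mass_1: "mass 1 h = (\<Sum>i\<in>UNIV. c i * b1 $ i)"
  by (simp add: mass_def)

lemma mass_1_pos: "mass 1 h > 0"
  unfolding mass_1 using c_pos init by (intro sum_pos) auto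

lemma mass_pos: "t \<ge> 1 \<Longrightarrow> mass t h > 0"
  using mass_1_pos[of h] mass_mono[of 1 t h] by linarith

lemma adapted_mass: "s \<le> t \<Longrightarrow> adapted t (mass s)"
  unfolding mass_def using adapted_comp[OF adapted_beta, of s t "\<lambda>b. \<Sum>i\<in>UNIV. c i * (real s * b $ i)"] by simp

text \<open>\<open>W\<close> carries a time factor and the indicator of the event on which the drift
  is known. With \<open>x\<close> the mass, the expected relative decrease of \<open>1 / x\<close>
  is at least \<open>kap * (x / t) / (x + total)\<close>, and \<open>x / (x + total)\<close>
  increases with \<open>x\<close>; hence the factor \<open>K / (K + total)\<close>.\<close>

lemma inverse_mass_step:
  fixes W :: "(nat \<Rightarrow> 'n \<Rightarrow> bool) \<Rightarrow> real"
  assumes t: "t \<ge> 1" and W: "adapted t W" "\<And>h. W h \<ge> 0"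
    and K: "K > 0" and kap: "kap \<ge> 0"
    and drift: "\<And>h. W h \<noteq> 0 \<Longrightarrow> K \<le> mass t h \<and>
        kap * (\<Sum>i\<in>UNIV. c i * bt h t $ i) \<le> (\<Sum>i\<in>UNIV. c i * rate (bt h t) i)"
  shows "expectation (\<lambda>\<omega>. W (decl \<omega>) / mass (Suc t) (decl \<omega>))
    \<le> expectation (\<lambda>\<omega>. W (decl \<omega>) * (1 - kap * K / (K + total) / real t) / mass t (decl \<omega>))"
proof (rule expectation_step_le[OF t, where a = "\<lambda>h. W h / mass t h"
      and c = "\<lambda>i h. - (W h / (mass t h * (mass t h + total))) * c i"])
  have adt: "adapted t (\<lambda>h. f (W h) (mass t h))" for f :: "real \<Rightarrow> real \<Rightarrow> real"
    by (rule adapted_comp2[OF W(1) adapted_mass[OF order_refl]])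
  show "adapted t (\<lambda>h. W h / mass t h)" by (rule adt)
  show "adapted t (\<lambda>h. - (W h / (mass t h * (mass t h + total))) * c i)" for i
    using adt[of "\<lambda>w m. - (w / (m * (m + total))) * c i"] by simp
  show "adapted t (\<lambda>h. W h * (1 - kap * K / (K + total) / real t) / mass t h)"
    using adt[of "\<lambda>w m. w * (1 - kap * K / (K + total) / real t) / m"] by simp
  show "adapted (Suc t) (\<lambda>h. W h / mass (Suc t) h)"
    using adapted_comp2[OF adapted_mono[OF W(1)] adapted_mass[OF order_refl], of "Suc t" "(/)"] by simp
next
  fix h
  define d where "d = (\<Sum>i\<in>UNIV. c i * of_bool (h (Suc t) i))"
  define x where "x = mass t h"
  have x: "x > 0" unfolding x_def by (rule mass_pos[OF t])
  have "W h / mass (Suc t) h = W h * (1 / (x + d))"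
    by (simp add: mass_Suc[OF t] d_def x_def)
  also have "\<dots> \<le> W h * (1 / x - d / (x * (x + total)))"
    using x increment_bounds[of h t] by (intro mult_left_mono one_over_add_le W) (auto simp: d_def)
  also have "\<dots> = W h / x + - (W h / (x * (x + total))) * d"
    by (simp add: algebra_simps)
  also have "\<dots> = W h / x + (\<Sum>i\<in>UNIV. - (W h / (x * (x + total))) * c i * of_bool (h (Suc t) i))"
    unfolding d_def sum_distrib_left mult.assoc ..
  finally show "W h / mass (Suc t) h \<le> W h / mass t h
     + (\<Sum>i\<in>UNIV. - (W h / (mass t h * (mass t h + total))) * c i * of_bool (h (Suc t) i))"
    by (simp only: x_def)
next
  fix h
  define x where "x = mass t h"
  define S where "S = (\<Sum>i\<in>UNIV. c i * rate (bt h t) i)"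
  have x: "x > 0" unfolding x_def by (rule mass_pos[OF t])
  have le: "W h * (kap * K / (K + total) / real t) \<le> W h * (S / (x + total))"
  proof (cases "W h = 0")
    case False
    then have Kx: "K \<le> x" and S: "kap * (x / real t) \<le> S"
      using drift[of h] t by (auto simp: x_def S_def mass_eq)
    have "K / (K + total) \<le> x / (x + total)"
      using Kx K x total_pos by (simp add: field_simps)
    then have "kap * (K / (K + total)) / real t \<le> kap * (x / (x + total)) / real t"
      using kap by (intro divide_right_mono mult_left_mono) auto
    also have "\<dots> = kap * (x / real t) / (x + total)" by simp
    also have "\<dots> \<le> S / (x + total)"
      using S x total_pos by (intro divide_right_mono) auto
    finally show ?thesis by (intro mult_left_mono W) simp
  qed simp
  have "W h / x + (\<Sum>i\<in>UNIV. - (W h / (x * (x + total))) * c i * rate (bt h t) i)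
     = W h / x + - (W h / (x * (x + total))) * S"
    unfolding S_def sum_distrib_left mult.assoc ..
  also have "\<dots> = (W h - W h * (S / (x + total))) / x"
    using x by (simp add: diff_divide_distrib mult.commute)
  also have "\<dots> \<le> (W h - W h * (kap * K / (K + total) / real t)) / x"
    using x le by (intro divide_right_mono) auto
  also have "\<dots> = W h * (1 - kap * K / (K + total) / real t) / x"
    by (simp add: algebra_simps)
  finally show "W h / mass t h + (\<Sum>i\<in>UNIV. - (W h / (mass t h * (mass t h + total))) * c i * rate (bt h t) i)
    \<le> W h * (1 - kap * K / (K + total) / real t) / mass t h"
    by (simp only: x_def)
qed

text \<open>Any positive drift factor suffices: for a small power \<open>k\<close>, the quotient of
  \<open>t powr k\<close> by the mass is a supermartingale and almost surely does not tend to
  infinity, as it would if the mass were bounded.\<close>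

lemma AE_mass_unbounded:
  assumes kap: "kap > 0"
    and drift: "\<And>t h. t \<ge> 1 \<Longrightarrow>
        kap * (\<Sum>i\<in>UNIV. c i * bt h t $ i) \<le> (\<Sum>i\<in>UNIV. c i * rate (bt h t) i)"
  shows "AE \<omega> in M. \<forall>K. \<exists>t\<ge>1. K < mass t (decl \<omega>)"
proof -
  \<comment> \<open>The initial mass, a lower bound for the mass at all times
    \<open>t \<ge> 1\<close>.\<close>
  define K where "K = (\<Sum>i\<in>UNIV. c i * b1 $ i)"
  define k where "k = kap * K / (K + total)"
  have K: "K > 0" using mass_1_pos unfolding K_def mass_1 .
  have k: "k > 0" unfolding k_def using K kap total_pos by simp
  define Z where "Z t h = real t powr k / mass t h" for t h
  have adZ: "adapted t (\<lambda>h. a / mass t h)" for t and a :: real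
    using adapted_comp[OF adapted_mass[OF order_refl], where f = "\<lambda>m. a / m"] by simp
  have step: "expectation (\<lambda>\<omega>. Z (Suc t) (decl \<omega>)) \<le> expectation (\<lambda>\<omega>. Z t (decl \<omega>))" if t: "t \<ge> 1" for t
  proof -
    have "expectation (\<lambda>\<omega>. Z (Suc t) (decl \<omega>))
      \<le> expectation (\<lambda>\<omega>. real (Suc t) powr k * (1 - k / real t) / mass t (decl \<omega>))"
      unfolding Z_def k_def using mass_mono[OF order_refl t, unfolded mass_1] t kap
      by (intro inverse_mass_step adapted_const K conjI drift) (auto simp: mass_1 K_def)
    also have "\<dots> \<le> expectation (\<lambda>\<omega>. Z t (decl \<omega>))"
    proof (intro integral_mono integrable_adapted)
      show "adapted t (\<lambda>h. real (Suc t) powr k * (1 - k / real t) / mass t h)" "adapted t (Z t)"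
        unfolding Z_def by (rule adZ)+
      fix \<omega>
      have tp: "real t > 0" using t by simp
      \<comment> \<open>The aim is \<open>(1 + 1/t) powr k * (1 - k/t) \<le> 1\<close>, by comparing
        the factors with \<open>exp (k/t)\<close> and \<open>exp (- k/t)\<close>.\<close>
      have "real (Suc t) powr k = real t powr k * (1 + 1 / real t) powr k"
      proof -
        have "real (Suc t) = real t * (1 + 1 / real t)" using tp by (simp add: distrib_left)
        then show ?thesis using tp by (simp only: powr_mult)
      qed
      also have "(1 + 1 / real t) powr k = exp (k * ln (1 + 1 / real t))"
      proof -
        have "1 + 1 / real t > 0" using tp by (intro add_pos_pos) auto
        then show ?thesis by (simp only: powr_def less_imp_neq[symmetric] if_False)
      qed
      also have "\<dots> \<le> exp (k * (1 / real t))"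
        using k tp mult_left_mono[OF ln_add_one_self_le_self[of "1 / real t"], of k] by simp
      finally have a: "real (Suc t) powr k \<le> real t powr k * exp (k / real t)"
        by (simp add: mult_left_mono)
      have b: "1 - k / real t \<le> exp (- (k / real t))"
        using exp_ge_add_one_self[of "- (k / real t)"] by simp
      have "real (Suc t) powr k * (1 - k / real t) \<le> real (Suc t) powr k * exp (- (k / real t))"
        by (intro mult_left_mono b) simp
      also have "\<dots> \<le> real t powr k * exp (k / real t) * exp (- (k / real t))"
        by (intro mult_right_mono a) simp
      also have "\<dots> = real t powr k" by (simp add: mult.assoc exp_add[symmetric])
      finally show "real (Suc t) powr k * (1 - k / real t) / mass t (decl \<omega>) \<le> Z t (decl \<omega>)"
        unfolding Z_def using mass_pos[OF t] by (intro divide_right_mono) (auto simp: less_imp_le)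
    qed
    finally show ?thesis .
  qed
  have "expectation (\<lambda>\<omega>. Z t (decl \<omega>)) \<le> expectation (\<lambda>\<omega>. Z 1 (decl \<omega>))" if "t \<ge> 1" for t
    using that by (induction t rule: dec_induct) (auto intro: order_trans[OF step])
  then have "AE \<omega> in M. \<not> filterlim (\<lambda>t. Z t (decl \<omega>)) at_top sequentially"
    using mass_pos
    by (intro AE_not_at_top_of_bounded_expectation[where s = 1 and B = "expectation (\<lambda>\<omega>. Z 1 (decl \<omega>))"])
       (auto simp: Z_def less_imp_le intro!: integrable_adapted adZ divide_nonneg_pos)
  then show ?thesis
  proof (rule AE_mp, intro AE_I2 impI notI)
    fix \<omega> assume nt: "\<not> filterlim (\<lambda>t. Z t (decl \<omega>)) at_top sequentially"
    show "\<forall>K. \<exists>t\<ge>1. K < mass t (decl \<omega>)"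
    proof (rule ccontr)
      assume "\<not> (\<forall>K. \<exists>t\<ge>1. K < mass t (decl \<omega>))"
      then obtain B where B: "\<And>t. t \<ge> 1 \<Longrightarrow> mass t (decl \<omega>) \<le> B" by (auto simp: not_less)
      have Bp: "B > 0" using B[of 1] mass_pos[of 1 "decl \<omega>"] by simp
      have "filterlim (\<lambda>t. real t powr k / B) at_top sequentially"
        using k Bp by real_asymp
      then have "filterlim (\<lambda>t. Z t (decl \<omega>)) at_top sequentially"
      proof (rule filterlim_at_top_mono)
        show "\<forall>\<^sub>F t in sequentially. real t powr k / B \<le> Z t (decl \<omega>)"
          using eventually_ge_at_top[of 1]
        proof eventually_elim
          case (elim t)
          then show ?case unfolding Z_def using B[OF elim] mass_pos[OF elim] Bp
            by (intro divide_left_mono) auto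
        qed
      qed
      with nt show False ..
    qed
  qed
qed

text \<open>\<open>K\<close> is chosen to make \<open>kap * K / (K + total) = 1\<close>. Once the
  mass has reached \<open>K\<close>, and while \<open>good\<close> holds, \<open>t / mass\<close> is
  a supermartingale, because \<open>(t + 1) * (1 - 1/t) \<le> t\<close>.\<close>

lemma AE_not_absorbed:
  fixes good :: "real^'n \<Rightarrow> bool"
  assumes kap: "kap > 1" and s: "s \<ge> 1" and K: "K = total / (kap - 1)"
    and drift: "\<And>t h. t \<ge> 1 \<Longrightarrow> good (bt h t) \<Longrightarrow>
        kap * (\<Sum>i\<in>UNIV. c i * bt h t $ i) \<le> (\<Sum>i\<in>UNIV. c i * rate (bt h t) i)"
  shows "AE \<omega> in M. K \<le> mass s (decl \<omega>) \<longrightarrow> (\<forall>t\<ge>s. good (bt (decl \<omega>) t)) \<longrightarrow>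
    \<not> filterlim (\<lambda>t. real t / mass t (decl \<omega>)) at_top sequentially"
proof -
  have Kp: "K > 0" unfolding K using kap total_pos by simp
  have q: "kap * K / (K + total) = 1"
    unfolding K using kap total_pos by (simp add: field_simps)
  \<comment> \<open>Only times before \<open>t\<close> are tested, so that \<open>I (Suc t)\<close>
    is still determined by the history at \<open>t\<close>.\<close>
  define I where "I t h = (of_bool (K \<le> mass s h \<and> (\<forall>r\<in>{s..<t}. good (bt h r))) :: real)" for t h
  have adI: "adapted t (I n)" if "t \<ge> s" "n \<le> Suc t" for t n
    unfolding adapted_def I_def
  proof (intro allI impI)
    fix h h' :: "nat \<Rightarrow> 'n \<Rightarrow> bool" assume eq: "\<forall>k\<in>{2..t}. h k = h' k"
    have "bt h r = bt h' r" if "r \<le> t" for r using eq that by (intro beta_cong) auto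
    moreover have "mass s h = mass s h'" using eq by (intro adaptedD[OF adapted_mass[OF \<open>t \<ge> s\<close>]]) auto
    ultimately show "(of_bool (K \<le> mass s h \<and> (\<forall>r\<in>{s..<n}. good (bt h r))) :: real)
       = of_bool (K \<le> mass s h' \<and> (\<forall>r\<in>{s..<n}. good (bt h' r)))"
      using \<open>n \<le> Suc t\<close> by auto
  qed
  define Z where "Z t h = real t * I t h / mass t h" for t h
  have adZ: "adapted t (Z t)" if "t \<ge> s" for t
    unfolding Z_def using adapted_comp2[OF adI[OF that le_SucI[OF order_refl]] adapted_mass[OF order_refl], of "\<lambda>x m. real t * x / m"] .
  have step: "expectation (\<lambda>\<omega>. Z (Suc t) (decl \<omega>)) \<le> expectation (\<lambda>\<omega>. Z t (decl \<omega>))" if ts: "t \<ge> s" for t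
  proof -
    have t: "t \<ge> 1" using ts s by simp
    have W: "adapted t (\<lambda>h. real (Suc t) * I (Suc t) h)" by (rule adapted_comp[OF adI[OF ts order_refl]])
    have "expectation (\<lambda>\<omega>. Z (Suc t) (decl \<omega>))
      \<le> expectation (\<lambda>\<omega>. real (Suc t) * I (Suc t) (decl \<omega>) * (1 - kap * K / (K + total) / real t) / mass t (decl \<omega>))"
      unfolding Z_def
    proof (rule inverse_mass_step[OF t W _ Kp])
      fix h assume "real (Suc t) * I (Suc t) h \<noteq> 0"
      then have "K \<le> mass s h" "good (bt h t)" using ts by (auto simp: I_def split: if_splits)
      then show "K \<le> mass t h \<and>
        kap * (\<Sum>i\<in>UNIV. c i * bt h t $ i) \<le> (\<Sum>i\<in>UNIV. c i * rate (bt h t) i)"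
        using mass_mono[OF s ts, of h] drift[OF t] by auto
    qed (use kap in \<open>auto simp: I_def\<close>)
    also have "\<dots> \<le> expectation (\<lambda>\<omega>. Z t (decl \<omega>))"
      unfolding q
    proof (intro integral_mono integrable_adapted[OF adZ[OF ts]] integrable_adapted)
      show "adapted t (\<lambda>h. real (Suc t) * I (Suc t) h * (1 - 1 / real t) / mass t h)"
        using adapted_comp2[OF adI[OF ts order_refl] adapted_mass[OF order_refl], of "\<lambda>x m. real (Suc t) * x * (1 - 1 / real t) / m"] .
      fix \<omega>
      have "I (Suc t) (decl \<omega>) \<le> I t (decl \<omega>)" by (auto simp: I_def)
      moreover have "real (Suc t) * (1 - 1 / real t) \<le> real t" using t by (simp add: field_simps)
      moreover have "0 \<le> I (Suc t) (decl \<omega>)" by (simp add: I_def)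
      ultimately have "(real (Suc t) * (1 - 1 / real t)) * I (Suc t) (decl \<omega>) \<le> real t * I t (decl \<omega>)"
        by (intro mult_mono) auto
      then show "real (Suc t) * I (Suc t) (decl \<omega>) * (1 - 1 / real t) / mass t (decl \<omega>) \<le> Z t (decl \<omega>)"
        unfolding Z_def using mass_pos[OF t, of "decl \<omega>"]
        by (intro divide_right_mono) (auto simp: mult_ac)
    qed
    finally show ?thesis .
  qed
  have "expectation (\<lambda>\<omega>. Z t (decl \<omega>)) \<le> expectation (\<lambda>\<omega>. Z s (decl \<omega>))" if "t \<ge> s" for t
    using that by (induction t rule: dec_induct) (auto intro: order_trans[OF step])
  moreover have "Z t h \<ge> 0" if "t \<ge> s" for t h
    using mass_pos[of t h] that s by (auto simp: Z_def I_def)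
  ultimately have "AE \<omega> in M. \<not> filterlim (\<lambda>t. Z t (decl \<omega>)) at_top sequentially"
    by (intro AE_not_at_top_of_bounded_expectation[where s = s and B = "expectation (\<lambda>\<omega>. Z s (decl \<omega>))"])
       (auto intro: integrable_adapted[OF adZ])
  then show ?thesis
  proof (rule AE_mp, intro AE_I2 impI)
    fix \<omega> assume nt: "\<not> filterlim (\<lambda>t. Z t (decl \<omega>)) at_top sequentially"
      and "K \<le> mass s (decl \<omega>)" "\<forall>t\<ge>s. good (bt (decl \<omega>) t)"
    then have "Z t (decl \<omega>) = real t / mass t (decl \<omega>)" for t
      by (simp add: Z_def I_def)
    then show "\<not> filterlim (\<lambda>t. real t / mass t (decl \<omega>)) at_top sequentially"
      using nt by simp
  qed
qed

end

lemma AE_not_tendsto_zero: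
  assumes l: "lambda_max (Jac A gam (vec 0)) > 1"
  shows "AE \<omega> in M. \<not> (\<lambda>t. bt (decl \<omega>) t) \<longlonglongrightarrow> vec 0"
proof -
  define l where "l = lambda_max (Jac A gam (vec 0))"
  obtain u where u: "\<And>i. u $ i > 0"
    "\<And>i. adj i u = lambda_max (Jac A gam (vec 0)) * (jweight gam $ i * u $ i)"
    "\<And>v. qform v \<le> lambda_max (Jac A gam (vec 0)) * wsum (jweight gam) v"
    by (rule perron_Jac[OF gam_pos]) (rule that)
  note u = u(1) u(2)[folded l_def]
  have l1: "l > 1" using assms by (simp add: l_def)
  define c where "c i = jweight gam $ i * u $ i" for i
  have c: "c i > 0" for i
    using gam_pos[of i] deg_pos[of i] u(1)[of i] by (simp add: c_def jweight_def)
  define r0 where "r0 = Max (range (\<lambda>i. gam $ i))"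
  have r0: "gam $ i \<le> r0" for i unfolding r0_def by (rule Max_ge) auto
  have r0p: "r0 > 0" using r0[of undefined] gam_pos[of undefined] by linarith
  \<comment> \<open>A crude bound valid everywhere; its factor may be below \<open>1\<close>, which
    is enough for an unbounded mass.\<close>
  have drift0: "l / (1 + r0) * (\<Sum>i\<in>UNIV. c i * bt h t $ i) \<le> (\<Sum>i\<in>UNIV. c i * rate (bt h t) i)" for h t
    unfolding c_def
  proof (rule perron_drift[OF u])
    fix i
    have "(gam $ i - 1) * mu A (bt h t) i \<le> gam $ i * mu A (bt h t) i"
      using mu_bt_range[of h t i] by (simp add: algebra_simps)
    also have "\<dots> \<le> gam $ i * 1"
      using mu_bt_range[of h t i] gam_pos[of i] by (intro mult_left_mono) auto
    finally show "(gam $ i - 1) * mu A (bt h t) i \<le> r0" using r0[of i] by simp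
  qed
  \<comment> \<open>With \<open>1 + r\<close> halfway between \<open>1\<close> and \<open>l\<close>,
    the factor is \<open>kap = 2 * l / (l + 1) > 1\<close>.\<close>
  define r where "r = (l - 1) / 2"
  define good where "good b \<longleftrightarrow> (\<forall>i. (gam $ i - 1) * mu A b i \<le> r)" for b
  define kap where "kap = l / (1 + r)"
  have rp: "r > 0" using l1 by (simp add: r_def)
  have kap: "kap > 1" using l1 by (simp add: kap_def r_def field_simps)
  have drift: "kap * (\<Sum>i\<in>UNIV. c i * bt h t $ i) \<le> (\<Sum>i\<in>UNIV. c i * rate (bt h t) i)"
    if "good (bt h t)" for h t
    unfolding c_def kap_def by (rule perron_drift[OF u]) (use that in \<open>simp add: good_def\<close>)
  define K where "K = total c / (kap - 1)"
  have "AE \<omega> in M. \<forall>K. \<exists>t\<ge>1. K < mass c t (decl \<omega>)"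
    by (rule AE_mass_unbounded[OF c _ drift0]) (use l1 r0p in auto)
  \<comment> \<open>The time from which on \<open>good\<close> holds is random, so all of the
    countably many starting times are treated at once.\<close>
  moreover have "AE \<omega> in M. \<forall>s\<in>{1..}. K \<le> mass c s (decl \<omega>) \<longrightarrow> (\<forall>t\<ge>s. good (bt (decl \<omega>) t)) \<longrightarrow>
    \<not> filterlim (\<lambda>t. real t / mass c t (decl \<omega>)) at_top sequentially"
    by (subst AE_ball_countable) (auto intro!: AE_not_absorbed[OF c kap _ K_def drift])
  ultimately show ?thesis
  proof (eventually_elim, intro notI)
    fix \<omega>
    assume unb: "\<forall>K. \<exists>t\<ge>1. K < mass c t (decl \<omega>)"
      and na: "\<forall>s\<in>{1..}. K \<le> mass c s (decl \<omega>) \<longrightarrow> (\<forall>t\<ge>s. good (bt (decl \<omega>) t)) \<longrightarrow>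
        \<not> filterlim (\<lambda>t. real t / mass c t (decl \<omega>)) at_top sequentially"
      and lim: "(\<lambda>t. bt (decl \<omega>) t) \<longlonglongrightarrow> vec 0"
    have comp: "(\<lambda>t. bt (decl \<omega>) t $ i) \<longlonglongrightarrow> 0" for i
      using tendsto_vec_nth[OF lim, of i] by simp
    have "(\<lambda>t. (gam $ i - 1) * mu A (bt (decl \<omega>) t) i) \<longlonglongrightarrow> (gam $ i - 1) * ((\<Sum>j\<in>UNIV. A $ i $ j * 0) / deg A i)" for i
      unfolding mu_def by (intro tendsto_intros comp) (use deg_pos[of i] in simp)
    then have "(\<lambda>t. (gam $ i - 1) * mu A (bt (decl \<omega>) t) i) \<longlonglongrightarrow> 0" for i by simp
    then have "\<forall>\<^sub>F t in sequentially. (gam $ i - 1) * mu A (bt (decl \<omega>) t) i \<le> r" for i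
      by (rule eventually_mono[OF order_tendstoD(2)[OF _ rp]]) (rule less_imp_le)
    then have "\<forall>\<^sub>F t in sequentially. good (bt (decl \<omega>) t)"
      unfolding good_def by (rule eventually_all_finite)
    then obtain s1 where s1: "\<And>t. t \<ge> s1 \<Longrightarrow> good (bt (decl \<omega>) t)"
      by (auto simp: eventually_sequentially)
    obtain s2 where s2: "s2 \<ge> 1" "K < mass c s2 (decl \<omega>)" using unb by blast
    define s where "s = max s1 s2"
    have "s \<ge> 1" "\<And>t. t \<ge> s \<Longrightarrow> good (bt (decl \<omega>) t)" using s1 s2 by (auto simp: s_def)
    moreover have "K \<le> mass c s (decl \<omega>)"
      using s2 mass_mono[where c = c and t = s and h = "decl \<omega>", OF c s2(1)] by (simp add: s_def)
    ultimately have nt: "\<not> filterlim (\<lambda>t. real t / mass c t (decl \<omega>)) at_top sequentially"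
      using na by auto
    \<comment> \<open>The weighted opinion is \<open>mass / t\<close>; it tends to \<open>0\<close>
      from above, so its inverse tends to infinity.\<close>
    have "(\<lambda>t. \<Sum>i\<in>UNIV. c i * bt (decl \<omega>) t $ i) \<longlonglongrightarrow> (\<Sum>i\<in>UNIV. c i * 0)"
      by (intro tendsto_intros comp)
    then have "filterlim (\<lambda>t. inverse (\<Sum>i\<in>UNIV. c i * bt (decl \<omega>) t $ i)) at_top sequentially"
      using c bt_range by (intro filterlim_inverse_at_top always_eventually allI sum_pos) auto
    moreover have "\<forall>\<^sub>F t in sequentially. inverse (\<Sum>i\<in>UNIV. c i * bt (decl \<omega>) t $ i) = real t / mass c t (decl \<omega>)"
      using eventually_ge_at_top[of 1]
      by eventually_elim (simp add: mass_eq[OF c] inverse_eq_divide)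
    ultimately have "filterlim (\<lambda>t. real t / mass c t (decl \<omega>)) at_top sequentially"
      by (rule filterlim_cong[THEN iffD1, OF refl refl, rotated])
    with nt show False ..
  qed
qed

section \<open>Descent\<close>

text \<open>Squared defects in the fixed-point equation, weighted to match the descent in
  \<open>fbias_inv_descent\<close>.\<close>

definition residual :: "real^'n \<Rightarrow> real" where
  "residual b = (\<Sum>i\<in>UNIV. deg A i * (min (gam $ i) 1 / max (gam $ i) 1) * (rate b i - b $ i)\<^sup>2)"

lemma residual_nonneg: "residual b \<ge> 0"
  unfolding residual_def using deg_pos gam_pos
  by (intro sum_nonneg mult_nonneg_nonneg divide_nonneg_nonneg) (auto simp: less_imp_le max_def min_def)

lemma residual_zeroD:
  assumes "residual b = 0"
  shows "rate b i = b $ i"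
proof -
  have p: "deg A i * (min (gam $ i) 1 / max (gam $ i) 1) > 0" for i
    using deg_pos[of i] gam_pos[of i] by (intro mult_pos_pos divide_pos_pos) auto
  have nn: "0 \<le> deg A i * (min (gam $ i) 1 / max (gam $ i) 1) * (rate b i - b $ i)\<^sup>2" for i
    by (intro mult_nonneg_nonneg[OF less_imp_le[OF p]]) simp
  have "\<forall>i\<in>UNIV. deg A i * (min (gam $ i) 1 / max (gam $ i) 1) * (rate b i - b $ i)\<^sup>2 = 0"
    by (rule sum_nonneg_eq_0_iff[THEN iffD1, OF finite nn assms[unfolded residual_def]])
  then have "deg A i * (min (gam $ i) 1 / max (gam $ i) 1) * (rate b i - b $ i)\<^sup>2 = 0" by blast
  then have "(rate b i - b $ i)\<^sup>2 = 0" using p[of i] by (metis less_irrefl mult_eq_0_iff)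
  then show ?thesis by simp
qed

lemma adapted_residual: "adapted t (\<lambda>h. residual (bt h t))"
  by (rule adapted_comp[OF adapted_beta[OF order_refl]])

lemma integrable_residual: "integrable M (\<lambda>\<omega>. residual (bt (decl \<omega>) t) / (real t + 1))"
  by (rule integrable_adapted[OF adapted_comp[OF adapted_residual[of t], where f = "\<lambda>x. x / (real t + 1)"]])

lemma bt_increment:
  assumes "t \<ge> 1"
  shows "\<bar>bt h (Suc t) $ i - bt h t $ i\<bar> \<le> 1 / (real t + 1)"
proof -
  have "\<bar>of_bool (h (Suc t) i) - bt h t $ i\<bar> \<le> 1"
    using bt_range[of h t i] by (auto simp: of_bool_def)
  then have "\<bar>of_bool (h (Suc t) i) - bt h t $ i\<bar> / (real t + 1) \<le> 1 / (real t + 1)"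
    by (intro divide_right_mono) auto
  moreover have "bt h (Suc t) $ i - bt h t $ i = (of_bool (h (Suc t) i) - bt h t $ i) / (real t + 1)"
    unfolding beta_Suc[OF assms] by simp
  ultimately show ?thesis by (simp del: beta.simps)
qed

text \<open>The symmetry of \<open>A\<close> makes \<open>\<Sum> deg(i) H\<^sub>i(b\<^sub>i) - b\<^sup>T A b / 2\<close>, where \<open>H\<^sub>i\<close> is an antiderivative of the
  inverse of \<open>f(\<cdot>, \<gamma>\<^sub>i)\<close>, a strict Lyapunov function of the mean-field dynamics.\<close>

lemma lyapunov:
  obtains E :: "real^'n \<Rightarrow> real" and C B where
    "\<And>t h. t \<ge> 1 \<Longrightarrow> E (bt h (Suc t)) \<le> E (bt h t)
       + (\<Sum>i\<in>UNIV. deg A i * (fbias_inv (bt h t $ i) (gam $ i) - mu A (bt h t) i)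
            * (bt h (Suc t) $ i - bt h t $ i)) + C / (real t + 1)\<^sup>2"
    "\<And>t h. B \<le> E (bt h t)" "C \<ge> 0"
proof -
  have "\<forall>i. \<exists>H L. L \<ge> 0 \<and> (\<forall>a\<in>{0..1}. \<forall>b\<in>{0..1}.
      H b \<le> H a + fbias_inv a (gam $ i) * (b - a) + L * (b - a)\<^sup>2)"
    using fbias_inv_antiderivative[OF gam_pos] by blast
  then obtain H L where L: "\<And>i. L i \<ge> 0"
    and H: "\<And>i a b. a \<in> {0..1} \<Longrightarrow> b \<in> {0..1} \<Longrightarrow>
      H i b \<le> H i a + fbias_inv a (gam $ i) * (b - a) + L i * (b - a)\<^sup>2"
    by metis
  \<comment> \<open>By symmetry of \<open>A\<close>, the partial derivative in \<open>b $ i\<close>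
    is \<open>deg A i\<close> times \<open>fbias_inv (b $ i) (gam $ i) - mu A b i\<close>.\<close>
  define E where "E b = (\<Sum>i\<in>UNIV. deg A i * H i (b $ i)) - qform b / 2" for b :: "real^'n"
  define C where "C = (\<Sum>i\<in>UNIV. deg A i * L i) + (\<Sum>i\<in>UNIV. deg A i) / 2"
  define B where "B = (\<Sum>i\<in>UNIV. deg A i * (H i 0 - L i)) - (\<Sum>i\<in>UNIV. deg A i) / 2"
  have C: "C \<ge> 0" unfolding C_def using deg_pos L
    by (intro add_nonneg_nonneg divide_nonneg_nonneg sum_nonneg mult_nonneg_nonneg) (auto simp: less_imp_le)
  have lower: "B \<le> E (bt h t)" for h t
  proof -
    \<comment> \<open>The quadratic bound from \<open>bt h t $ i\<close> to \<open>0\<close>, with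
      its nonpositive linear term dropped.\<close>
    have "H i 0 - L i \<le> H i (bt h t $ i)" for i
    proof -
      have r: "0 \<le> bt h t $ i" "bt h t $ i \<le> 1" using bt_range[of h t i] by auto
      have "fbias_inv (bt h t $ i) (gam $ i) \<ge> 0"
        unfolding fbias_inv_def using fbias_inv_den_pos[OF r gam_pos[of i]] r by simp
      then have "fbias_inv (bt h t $ i) (gam $ i) * bt h t $ i \<ge> 0" using r by simp
      moreover have "L i * (bt h t $ i)\<^sup>2 \<le> L i * 1"
        using r L by (intro mult_left_mono power_le_one) auto
      ultimately show ?thesis using H[of "bt h t $ i" 0 i] r by simp
    qed
    then have "(\<Sum>i\<in>UNIV. deg A i * (H i 0 - L i)) \<le> (\<Sum>i\<in>UNIV. deg A i * H i (bt h t $ i))"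
      using deg_pos by (intro sum_mono mult_left_mono) (auto simp: less_imp_le)
    moreover have "\<bar>bt h t $ i\<bar> \<le> 1" for i using bt_range[of h t i] by auto
    then have "\<bar>qform (bt h t)\<bar> \<le> 1\<^sup>2 * (\<Sum>i\<in>UNIV. deg A i)" by (rule qform_bound)
    ultimately show ?thesis unfolding E_def B_def by simp
  qed
  have step: "E (bt h (Suc t)) \<le> E (bt h t)
       + (\<Sum>i\<in>UNIV. deg A i * (fbias_inv (bt h t $ i) (gam $ i) - mu A (bt h t) i)
            * (bt h (Suc t) $ i - bt h t $ i)) + C / (real t + 1)\<^sup>2" if t: "t \<ge> 1" for t h
  proof -
    define b b' where "b = bt h t" and "b' = bt h (Suc t)"
    define e where "e = 1 / (real t + 1)"
    have d: "\<bar>(b' - b) $ i\<bar> \<le> e" for i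
      using bt_increment[OF t, of h i] by (simp only: vector_minus_component b_def b'_def e_def)
    have r: "b $ i \<in> {0..1}" "b' $ i \<in> {0..1}" for i
      unfolding b_def b'_def using bt_range[of h t i] bt_range[of h "Suc t" i] by (auto simp del: beta.simps)
    have "H i (b' $ i) \<le> H i (b $ i) + fbias_inv (b $ i) (gam $ i) * (b' $ i - b $ i) + L i * e\<^sup>2" for i
    proof -
      have "(b' $ i - b $ i)\<^sup>2 \<le> e\<^sup>2"
        using power_mono[OF d[of i] abs_ge_zero, of 2] by simp
      then have "L i * (b' $ i - b $ i)\<^sup>2 \<le> L i * e\<^sup>2" using L by (intro mult_left_mono) auto
      then show ?thesis using H[OF r, of i] by (smt (verit))
    qed
    then have "(\<Sum>i\<in>UNIV. deg A i * H i (b' $ i))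
      \<le> (\<Sum>i\<in>UNIV. deg A i * (H i (b $ i) + fbias_inv (b $ i) (gam $ i) * (b' $ i - b $ i) + L i * e\<^sup>2))"
      using deg_pos by (intro sum_mono mult_left_mono) (auto simp: less_imp_le)
    also have "\<dots> = (\<Sum>i\<in>UNIV. deg A i * H i (b $ i))
       + (\<Sum>i\<in>UNIV. deg A i * fbias_inv (b $ i) (gam $ i) * (b' $ i - b $ i))
       + (\<Sum>i\<in>UNIV. deg A i * L i) * e\<^sup>2"
      by (simp only: sum.distrib distrib_left sum_distrib_right mult.assoc)
    finally have 1: "(\<Sum>i\<in>UNIV. deg A i * H i (b' $ i)) \<le> \<dots>" .
    \<comment> \<open>Exact expansion along the whole step; the last term is of second order in the
      step size.\<close>
    have "qform b' = qform b + 2 * (\<Sum>i\<in>UNIV. (b' - b) $ i * adj i b) + qform (b' - b)"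
      using qform_add[of b 1 "b' - b"] by simp
    moreover have "\<bar>qform (b' - b)\<bar> \<le> e\<^sup>2 * (\<Sum>i\<in>UNIV. deg A i)" by (rule qform_bound[OF d])
    moreover have "(\<Sum>i\<in>UNIV. (b' - b) $ i * adj i b) = (\<Sum>i\<in>UNIV. deg A i * mu A b i * (b' $ i - b $ i))"
      unfolding adj_eq_mu vector_minus_component by (intro sum.cong refl) (rule mult.commute)
    ultimately have 2: "- qform b' / 2 \<le> - qform b / 2
       - (\<Sum>i\<in>UNIV. deg A i * mu A b i * (b' $ i - b $ i)) + (\<Sum>i\<in>UNIV. deg A i) / 2 * e\<^sup>2"
      by (simp add: field_simps abs_le_iff)
    have 3: "(\<Sum>i\<in>UNIV. deg A i * (fbias_inv (b $ i) (gam $ i) - mu A b i) * (b' $ i - b $ i))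
      = (\<Sum>i\<in>UNIV. deg A i * fbias_inv (b $ i) (gam $ i) * (b' $ i - b $ i))
        - (\<Sum>i\<in>UNIV. deg A i * mu A b i * (b' $ i - b $ i))"
      by (simp only: right_diff_distrib left_diff_distrib sum_subtractf)
    have 4: "C / (real t + 1)\<^sup>2 = (\<Sum>i\<in>UNIV. deg A i * L i) * e\<^sup>2 + (\<Sum>i\<in>UNIV. deg A i) / 2 * e\<^sup>2"
      unfolding C_def e_def by (simp only: power_divide power_one distrib_right) (simp add: add_divide_distrib)
    have "E b' \<le> E b + (\<Sum>i\<in>UNIV. deg A i * (fbias_inv (b $ i) (gam $ i) - mu A b i) * (b' $ i - b $ i))
       + C / (real t + 1)\<^sup>2"
      using 1 2 unfolding E_def 3 4 by linarith
    then show ?thesis unfolding b_def b'_def .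
  qed
  show thesis by (rule that[OF step lower C])
qed

text \<open>In expectation the first-order term of \<open>lyapunov\<close> is at most minus the
  residual over \<open>t + 1\<close>. Telescoping, the lower bound on \<open>E\<close> and the
  summable error bound the total.\<close>

lemma summable_expected_residual:
  "\<exists>B. \<forall>T\<ge>1. expectation (\<lambda>\<omega>. \<Sum>t\<in>{1..<T}. residual (bt (decl \<omega>) t) / (real t + 1)) \<le> B"
proof -
  obtain E C B where E: "\<And>t h. t \<ge> 1 \<Longrightarrow> E (bt h (Suc t)) \<le> E (bt h t)
       + (\<Sum>i\<in>UNIV. deg A i * (fbias_inv (bt h t $ i) (gam $ i) - mu A (bt h t) i)
            * (bt h (Suc t) $ i - bt h t $ i)) + C / (real t + 1)\<^sup>2"
    and B: "\<And>t h. B \<le> E (bt h t)" and C: "C \<ge> 0"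
    by (rule lyapunov) (rule that)
  have adE: "adapted t (\<lambda>h. E (bt h t))" for t
    by (rule adapted_comp[OF adapted_beta[OF order_refl]])
  have adb: "adapted t (\<lambda>h. F (bt h t))" for t and F :: "real^'n \<Rightarrow> real"
    by (rule adapted_comp[OF adapted_beta[OF order_refl]])
  define v where "v t = expectation (\<lambda>\<omega>. residual (bt (decl \<omega>) t) / (real t + 1))" for t
  have descent: "expectation (\<lambda>\<omega>. E (bt (decl \<omega>) (Suc t))) \<le> expectation (\<lambda>\<omega>. E (bt (decl \<omega>) t)) - v t + C / (real t + 1)\<^sup>2"
    if t: "t \<ge> 1" for t
  proof -
    define e where "e = 1 / (real t + 1)"
    have e: "e \<ge> 0" by (simp add: e_def)
    define w where "w b i = deg A i * (fbias_inv (b $ i) (gam $ i) - mu A b i)" for b :: "real^'n" and i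
    have "expectation (\<lambda>\<omega>. E (bt (decl \<omega>) (Suc t)))
      \<le> expectation (\<lambda>\<omega>. E (bt (decl \<omega>) t) - residual (bt (decl \<omega>) t) / (real t + 1) + C / (real t + 1)\<^sup>2)"
    \<comment> \<open>The bound of \<open>lyapunov\<close> is affine in the new declarations;
      \<open>a\<close> collects what is known at time \<open>t\<close>.\<close>
    proof (rule expectation_step_le[OF t, where c = "\<lambda>i h. e * w (bt h t) i"
          and a = "\<lambda>h. E (bt h t) + C / (real t + 1)\<^sup>2 - (\<Sum>i\<in>UNIV. e * w (bt h t) i * bt h t $ i)"])
      fix h
      define b where "b = bt h t"
      have eq: "bt h (Suc t) $ i - b $ i = e * (of_bool (h (Suc t) i) - b $ i)" for i
        unfolding b_def e_def using beta_Suc[OF t, of b1 h i] by (simp del: beta.simps)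
      have "(\<Sum>i\<in>UNIV. deg A i * (fbias_inv (b $ i) (gam $ i) - mu A b i) * (bt h (Suc t) $ i - b $ i))
         = (\<Sum>i\<in>UNIV. e * w b i * of_bool (h (Suc t) i) - e * w b i * b $ i)"
        unfolding eq w_def by (intro sum.cong refl) (simp add: algebra_simps)
      then show "E (bt h (Suc t)) \<le> E (bt h t) + C / (real t + 1)\<^sup>2 - (\<Sum>i\<in>UNIV. e * w (bt h t) i * bt h t $ i)
          + (\<Sum>i\<in>UNIV. e * w (bt h t) i * of_bool (h (Suc t) i))"
        using E[OF t, of h] unfolding b_def sum_subtractf by linarith
      have "(\<Sum>i\<in>UNIV. e * w b i * rate b i) - (\<Sum>i\<in>UNIV. e * w b i * b $ i)
          = e * (\<Sum>i\<in>UNIV. deg A i * ((fbias_inv (b $ i) (gam $ i) - mu A b i) * (rate b i - b $ i)))"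
        unfolding sum_subtractf[symmetric] sum_distrib_left w_def
        by (intro sum.cong refl) (simp add: algebra_simps)
      also have "\<dots> \<le> e * (\<Sum>i\<in>UNIV. deg A i * (- (min (gam $ i) 1 / max (gam $ i) 1) * (rate b i - b $ i)\<^sup>2))"
      proof (intro mult_left_mono sum_mono e)
        fix i
        show "(fbias_inv (b $ i) (gam $ i) - mu A b i) * (rate b i - b $ i)
           \<le> - (min (gam $ i) 1 / max (gam $ i) 1) * (rate b i - b $ i)\<^sup>2"
          unfolding rate_def b_def
          using bt_range[of h t i] mu_bt_range[of h t i] by (intro fbias_inv_descent gam_pos) auto
        show "0 \<le> deg A i" using deg_pos[of i] by simp
      qed
      also have "\<dots> = - (residual b / (real t + 1))"
        unfolding residual_def e_def by (simp add: sum_negf mult.assoc)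
      finally show "E (bt h t) + C / (real t + 1)\<^sup>2 - (\<Sum>i\<in>UNIV. e * w (bt h t) i * bt h t $ i)
          + (\<Sum>i\<in>UNIV. e * w (bt h t) i * rate (bt h t) i)
        \<le> E (bt h t) - residual (bt h t) / (real t + 1) + C / (real t + 1)\<^sup>2"
        unfolding b_def by linarith
    qed (rule adE adb)+
    also have "\<dots> = expectation (\<lambda>\<omega>. E (bt (decl \<omega>) t)) - v t + C / (real t + 1)\<^sup>2"
      unfolding v_def using integrable_adapted[OF adE[of t]] integrable_residual[of t]
      by (simp add: prob_space)
    finally show ?thesis .
  qed
  have tele: "(\<Sum>t\<in>{1..<T}. v t) \<le> expectation (\<lambda>\<omega>. E (bt (decl \<omega>) 1)) - expectation (\<lambda>\<omega>. E (bt (decl \<omega>) T))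
      + (\<Sum>t\<in>{1..<T}. C / (real t + 1)\<^sup>2)" if "T \<ge> 1" for T
    using that
  proof (induction T rule: dec_induct)
    case (step T)
    then show ?case using descent[of T] by (simp del: beta.simps)
  qed simp
  have sumC: "(\<Sum>t\<in>{1..<T}. C / (real t + 1)\<^sup>2) \<le> C" if "T \<ge> 1" for T
  proof -
    have "(\<Sum>t\<in>{1..<T}. C / (real t + 1)\<^sup>2) \<le> C - C / real T"
      using that
    proof (induction T rule: dec_induct)
      case (step T)
      \<comment> \<open>Comparison with the telescoping \<open>1 / (T * (T + 1))\<close>.\<close>
      have "C / (real T + 1)\<^sup>2 \<le> C / (real T * (real T + 1))"
        using C step by (intro divide_left_mono) (auto simp: power2_eq_square)
      also have "\<dots> = C / real T - C / real (Suc T)"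
        using step by (simp add: field_simps)
      finally show ?case using step by simp
    qed simp
    then show ?thesis using C by (smt (verit) divide_nonneg_nonneg of_nat_0_le_iff)
  qed
  have "expectation (\<lambda>\<omega>. \<Sum>t\<in>{1..<T}. residual (bt (decl \<omega>) t) / (real t + 1))
     \<le> expectation (\<lambda>\<omega>. E (bt (decl \<omega>) 1)) - B + C" if T: "T \<ge> 1" for T
  proof -
    have "expectation (\<lambda>\<omega>. \<Sum>t\<in>{1..<T}. residual (bt (decl \<omega>) t) / (real t + 1)) = (\<Sum>t\<in>{1..<T}. v t)"
      unfolding v_def
      by (rule Bochner_Integration.integral_sum) (rule integrable_residual)
    moreover have "B \<le> expectation (\<lambda>\<omega>. E (bt (decl \<omega>) T))"
    proof -
      have "expectation (\<lambda>\<omega>. B) \<le> expectation (\<lambda>\<omega>. E (bt (decl \<omega>) T))"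
        by (intro integral_mono integrable_adapted[OF adE] B) simp
      then show ?thesis by (simp add: prob_space)
    qed
    ultimately show ?thesis using tele[OF T] sumC[OF T] by linarith
  qed
  then show ?thesis by blast
qed

text \<open>The partial sums increase and have bounded expectations; if unbounded they would tend to
  infinity, which is almost surely excluded.\<close>

lemma AE_residual_bounded:
  "AE \<omega> in M. \<exists>B. \<forall>T. (\<Sum>t\<in>{1..<T}. residual (bt (decl \<omega>) t) / (real t + 1)) \<le> B"
proof -
  define Z where "Z T \<omega> = (\<Sum>t\<in>{1..<T}. residual (bt (decl \<omega>) t) / (real t + 1))" for T \<omega>
  obtain B where B: "\<And>T. T \<ge> 1 \<Longrightarrow> expectation (Z T) \<le> B"
    using summable_expected_residual unfolding Z_def by blast
  have mono: "Z S \<omega> \<le> Z T \<omega>" if "S \<le> T" for S T \<omega>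
    unfolding Z_def using that residual_nonneg by (intro sum_mono2) auto
  have "AE \<omega> in M. \<not> filterlim (\<lambda>t. Z t \<omega>) at_top sequentially"
  proof (rule AE_not_at_top_of_bounded_expectation[where s = 1, OF _ _ B])
    fix T show "integrable M (Z T)"
      unfolding Z_def
      by (intro Bochner_Integration.integrable_sum integrable_residual)
  qed (auto simp: Z_def intro!: sum_nonneg divide_nonneg_nonneg residual_nonneg)
  then show ?thesis
  proof (rule AE_mp, intro AE_I2 impI)
    fix \<omega> assume nt: "\<not> filterlim (\<lambda>t. Z t \<omega>) at_top sequentially"
    show "\<exists>B. \<forall>T. (\<Sum>t\<in>{1..<T}. residual (bt (decl \<omega>) t) / (real t + 1)) \<le> B"
    proof (rule ccontr)
      assume "\<not> ?thesis"
      then have "\<exists>T. Z T \<omega> > B" for B by (auto simp: Z_def not_le)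
      then have "filterlim (\<lambda>t. Z t \<omega>) at_top sequentially"
        unfolding filterlim_at_top eventually_sequentially
        by (meson less_imp_le mono order_trans)
      with nt show False ..
    qed
  qed
qed

text \<open>Opinions with mean between \<open>e\<close> and \<open>1 - e\<close> are never fixed
  points, so by compactness \<open>residual\<close> has a positive lower bound on them, and the
  bounded residual sum limits the harmonic weight of the times spent there. The slow sequence to
  which this applies is the mean opinion.\<close>

lemma AE_tendsto_vertex:
  assumes ne: "\<exists>i. gam $ i \<noteq> 1" and le1: "lambda_max (Jac A gam (vec 0)) \<le> 1"
  shows "AE \<omega> in M. (\<lambda>t. bt (decl \<omega>) t) \<longlonglongrightarrow> vec 0 \<or> (\<lambda>t. bt (decl \<omega>) t) \<longlonglongrightarrow> vec 1"
proof -
  define N where "N = real CARD('n)"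
  have N: "N > 0" by (simp add: N_def)
  define mean where "mean b = (\<Sum>i\<in>UNIV. b $ i) / N" for b :: "real^'n"
  have low: "\<exists>m>0. \<forall>b. (\<forall>i. 0 \<le> b $ i \<and> b $ i \<le> 1) \<longrightarrow> e \<le> mean b \<longrightarrow> mean b \<le> 1 - e \<longrightarrow> m \<le> residual b"
    if e: "e > 0" for e
  proof -
    define S where "S = cbox (vec 0 :: real^'n) (vec 1) \<inter> ({b. e \<le> mean b} \<inter> {b. mean b \<le> 1 - e})"
    have S: "b \<in> S \<longleftrightarrow> (\<forall>i. 0 \<le> b $ i \<and> b $ i \<le> 1) \<and> e \<le> mean b \<and> mean b \<le> 1 - e" for b
      by (auto simp: S_def mem_box_cart)
    have "compact S"
      unfolding S_def mean_def
      by (intro compact_Int_closed compact_cbox closed_Int closed_Collect_le continuous_intros) (use N in auto)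
    moreover have "continuous_on S residual"
      unfolding residual_def rate_def fbias_def mu_def
    proof (intro continuous_intros ballI)
      fix b i assume "b \<in> S"
      then have "0 \<le> mu A b i" "mu A b i \<le> 1" using mu_bounds[of b i] S by auto
      from fbias_pos_den[OF this gam_pos[of i]]
      show "1 + (gam $ i - 1) * ((\<Sum>j\<in>UNIV. A $ i $ j * b $ j) / deg A i) \<noteq> 0" by (simp add: mu_def)
    qed (simp_all add: less_imp_neq[OF deg_pos, symmetric])
    moreover have pos: "residual b > 0" if b: "b \<in> S" for b
    proof (rule ccontr)
      assume "\<not> residual b > 0"
      then have "residual b = 0" using residual_nonneg[of b] by simp
      then have "(\<forall>i. b $ i = 0) \<or> (\<forall>i. b $ i = 1)"
        using b S by (intro fixed_point_extreme[OF gam_pos ne le1]) (auto simp: rate_def[symmetric] dest: residual_zeroD)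
      then have "mean b = 0 \<or> mean b = 1" using N by (auto simp: mean_def N_def)
      then show False using b S e by auto
    qed
    show ?thesis
    proof (cases "S = {}")
      case True
      then have "\<not> ((\<forall>i. 0 \<le> b $ i \<and> b $ i \<le> 1) \<and> e \<le> mean b \<and> mean b \<le> 1 - e)" for b
        unfolding S[symmetric] by simp
      then show ?thesis by (metis zero_less_one)
    next
      case False
      obtain b0 where b0: "b0 \<in> S" "\<forall>b\<in>S. residual b0 \<le> residual b"
        using continuous_attains_inf[OF \<open>compact S\<close> False \<open>continuous_on S residual\<close>] by metis
      show ?thesis
      proof (intro exI[of _ "residual b0"] conjI allI impI)
        show "0 < residual b0" by (rule pos[OF b0(1)])
        fix b assume "\<forall>i. 0 \<le> b $ i \<and> b $ i \<le> 1" "e \<le> mean b" "mean b \<le> 1 - e"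
        then have "b \<in> S" unfolding S by simp
        then show "residual b0 \<le> residual b" using b0(2) by simp
      qed
    qed
  qed
  have mean_range: "0 \<le> mean (bt h t)" "mean (bt h t) \<le> 1" for h t
  proof -
    have "0 \<le> (\<Sum>i\<in>UNIV. bt h t $ i)" using bt_range by (intro sum_nonneg) (auto simp: less_imp_le)
    moreover have "(\<Sum>i\<in>UNIV. bt h t $ i) \<le> (\<Sum>i\<in>(UNIV::'n set). 1)"
      using bt_range by (intro sum_mono) (auto simp: less_imp_le)
    ultimately show "0 \<le> mean (bt h t)" "mean (bt h t) \<le> 1" using N by (auto simp: mean_def N_def)
  qed
  have mean_step: "\<bar>mean (bt h (Suc t)) - mean (bt h t)\<bar> \<le> 1 / (real t + 1)" if "t \<ge> 1" for h t
  proof -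
    have "\<bar>(\<Sum>i\<in>UNIV. bt h (Suc t) $ i) - (\<Sum>i\<in>UNIV. bt h t $ i)\<bar> \<le> (\<Sum>i\<in>UNIV. \<bar>bt h (Suc t) $ i - bt h t $ i\<bar>)"
      unfolding sum_subtractf[symmetric] by (rule sum_abs)
    also have "\<dots> \<le> (\<Sum>i\<in>(UNIV :: 'n set). 1 / (real t + 1))" by (intro sum_mono bt_increment that)
    also have "\<dots> = N * (1 / (real t + 1))" by (simp add: N_def)
    finally have "\<bar>(\<Sum>i\<in>UNIV. bt h (Suc t) $ i) - (\<Sum>i\<in>UNIV. bt h t $ i)\<bar> / N \<le> 1 / (real t + 1)"
      using N by (simp add: divide_le_eq mult.commute del: beta.simps)
    then show ?thesis using N unfolding mean_def diff_divide_distrib[symmetric] by (simp del: beta.simps)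
  qed
  from AE_residual_bounded show ?thesis
  proof (rule AE_mp, intro AE_I2 impI)
    fix \<omega> assume "\<exists>B. \<forall>T. (\<Sum>t\<in>{1..<T}. residual (bt (decl \<omega>) t) / (real t + 1)) \<le> B"
    then obtain B where B: "\<And>T. (\<Sum>t\<in>{1..<T}. residual (bt (decl \<omega>) t) / (real t + 1)) \<le> B" by blast
    define y where "y t = mean (bt (decl \<omega>) t)" for t
    have "y \<longlonglongrightarrow> 0 \<or> y \<longlonglongrightarrow> 1"
    proof (rule slow_sequence_dichotomy)
      show "0 \<le> y t \<and> y t \<le> 1" for t unfolding y_def using mean_range by blast
      show "\<bar>y (Suc t) - y t\<bar> \<le> 1 / (real t + 1)" if "t \<ge> 1" for t
        unfolding y_def by (rule mean_step[OF that])
      fix e :: real assume "e > 0"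
      then obtain m where m: "m > 0"
        and low: "\<And>b. \<forall>i. 0 \<le> b $ i \<and> b $ i \<le> 1 \<Longrightarrow> e \<le> mean b \<Longrightarrow> mean b \<le> 1 - e \<Longrightarrow> m \<le> residual b"
        using low by blast
      have "(\<Sum>t\<in>{1..<T}. of_bool (e \<le> y t \<and> y t \<le> 1 - e) / (real t + 1)) \<le> B / m" for T
      proof -
        have "(\<Sum>t\<in>{1..<T}. of_bool (e \<le> y t \<and> y t \<le> 1 - e) / (real t + 1))
          \<le> (\<Sum>t\<in>{1..<T}. residual (bt (decl \<omega>) t) / m / (real t + 1))"
        proof (intro sum_mono divide_right_mono)
          fix t
          show "of_bool (e \<le> y t \<and> y t \<le> 1 - e) \<le> residual (bt (decl \<omega>) t) / m"
            using low[of "bt (decl \<omega>) t"] bt_range[of "decl \<omega>" t] m residual_nonneg[of "bt (decl \<omega>) t"]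
            by (auto simp: y_def of_bool_def less_imp_le)
        qed simp
        also have "\<dots> = (\<Sum>t\<in>{1..<T}. residual (bt (decl \<omega>) t) / (real t + 1)) / m"
          by (simp add: sum_divide_distrib mult.commute)
        also have "\<dots> \<le> B / m" using B m by (intro divide_right_mono) auto
        finally show ?thesis .
      qed
      then show "\<exists>B. \<forall>T. (\<Sum>t\<in>{1..<T}. of_bool (e \<le> y t \<and> y t \<le> 1 - e) / (real t + 1)) \<le> B" by blast
    qed
    then show "(\<lambda>t. bt (decl \<omega>) t) \<longlonglongrightarrow> vec 0 \<or> (\<lambda>t. bt (decl \<omega>) t) \<longlonglongrightarrow> vec 1"
    proof
      assume y: "y \<longlonglongrightarrow> 0"
      \<comment> \<open>The components are nonnegative, so each is at most \<open>N\<close> times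
        the mean.\<close>
      have "(\<lambda>t. bt (decl \<omega>) t $ i) \<longlonglongrightarrow> 0" for i
      proof (rule tendsto_sandwich[where f = "\<lambda>_. 0" and h = "\<lambda>t. N * y t"])
        show "(\<lambda>t. N * y t) \<longlonglongrightarrow> 0" using tendsto_mult_left[OF y, of N] by simp
        show "\<forall>\<^sub>F t in sequentially. 0 \<le> bt (decl \<omega>) t $ i" using bt_range by (auto simp: less_imp_le)
        have "bt (decl \<omega>) t $ i \<le> (\<Sum>i\<in>UNIV. bt (decl \<omega>) t $ i)" for t
          by (rule member_le_sum) (use bt_range in \<open>auto simp: less_imp_le\<close>)
        then show "\<forall>\<^sub>F t in sequentially. bt (decl \<omega>) t $ i \<le> N * y t"
          using N by (simp add: y_def mean_def)
      qed simp
      then have "(\<lambda>t. bt (decl \<omega>) t) \<longlonglongrightarrow> vec 0" by (intro vec_tendstoI) simp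
      then show ?thesis ..
    next
      assume y: "y \<longlonglongrightarrow> 1"
      have "(\<lambda>t. bt (decl \<omega>) t $ i) \<longlonglongrightarrow> 1" for i
      proof (rule tendsto_sandwich[where f = "\<lambda>t. 1 - N * (1 - y t)" and h = "\<lambda>_. 1"])
        have "(\<lambda>t. 1 - N * (1 - y t)) \<longlonglongrightarrow> 1 - N * (1 - 1)" by (intro tendsto_intros y)
        then show "(\<lambda>t. 1 - N * (1 - y t)) \<longlonglongrightarrow> 1" by simp
        show "\<forall>\<^sub>F t in sequentially. bt (decl \<omega>) t $ i \<le> 1" using bt_range by (auto simp: less_imp_le)
        have "1 - bt (decl \<omega>) t $ i \<le> (\<Sum>i\<in>UNIV. 1 - bt (decl \<omega>) t $ i)" for t
          by (rule member_le_sum[of i UNIV "\<lambda>i. 1 - bt (decl \<omega>) t $ i"]) (use bt_range in \<open>auto simp: less_imp_le\<close>)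
        then have "1 - bt (decl \<omega>) t $ i \<le> N * (1 - y t)" for t
          using N by (simp add: y_def mean_def sum_subtractf N_def right_diff_distrib)
        then show "\<forall>\<^sub>F t in sequentially. 1 - N * (1 - y t) \<le> bt (decl \<omega>) t $ i"
          by (intro always_eventually allI) (simp add: algebra_simps)
      qed simp
      then have "(\<lambda>t. bt (decl \<omega>) t) \<longlonglongrightarrow> vec 1" by (intro vec_tendstoI) simp
      then show ?thesis ..
    qed
  qed
qed

section \<open>Exchange of the two declarations\<close>

definition flip_gam :: "real^'n" where "flip_gam = (\<chi> i. 1 / gam $ i)"
definition flip_b1 :: "real^'n" where "flip_b1 = (\<chi> i. 1 - b1 $ i)"

lemma beta_flip: "beta flip_b1 (\<lambda>k i. \<not> h k i) t = vec 1 - bt h t"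
proof (induction t)
  case (Suc t)
  show ?case
  proof (cases "t = 0")
    case False
    have "real (Suc t) * beta flip_b1 (\<lambda>k i. \<not> h k i) (Suc t) $ i = real (Suc t) * (vec 1 - bt h (Suc t)) $ i" for i
    proof -
      have t: "t \<ge> 1" using False by simp
      have "real (Suc t) * beta flip_b1 (\<lambda>k i. \<not> h k i) (Suc t) $ i
         = real t * (1 - bt h t $ i) + of_bool (\<not> h (Suc t) i)"
        unfolding real_beta_Suc[OF t] Suc by simp
      also have "\<dots> = real (Suc t) - (real t * bt h t $ i + of_bool (h (Suc t) i))"
        by (simp add: algebra_simps)
      also have "\<dots> = real (Suc t) * (vec 1 - bt h (Suc t)) $ i"
        unfolding real_beta_Suc[OF t, symmetric] by (simp add: right_diff_distrib del: beta.simps of_nat_Suc)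
      finally show ?thesis .
    qed
    then show ?thesis by (simp only: mult_cancel_left vec_eq_iff) (simp del: beta.simps)
  qed (simp add: flip_b1_def vec_eq_iff)
qed (simp add: flip_b1_def vec_eq_iff)

lemma mu_flip: "mu A (vec 1 - b) i = 1 - mu A b i"
  using deg_pos[of i] by (simp add: mu_def deg_def right_diff_distrib sum_subtractf diff_divide_distrib)

text \<open>Complementing all declarations gives a process of the same kind, by
  \<open>fbias_flip\<close>; so each statement about \<open>vec 0\<close> has a counterpart at
  \<open>vec 1\<close>.\<close>

lemma opinion_process_flip:
  "opinion_process A M flip_gam flip_b1 (\<lambda>t \<omega> i. \<not> Psi t \<omega> i)"
proof (unfold_locales)
  show "0 < flip_gam $ i" for i using gam_pos by (simp add: flip_gam_def)
  show "0 < flip_b1 $ i \<and> flip_b1 $ i < 1" for i using init by (simp add: flip_b1_def)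
  show "(\<lambda>\<omega>. \<not> Psi t \<omega> i) \<in> M \<rightarrow>\<^sub>M count_space UNIV" for t i by measurable
  fix t :: nat and h :: "nat \<Rightarrow> 'n \<Rightarrow> bool" and s :: "'n \<Rightarrow> bool" assume t: "1 \<le> t"
  \<comment> \<open>Complements, which turn events of the flipped process into events of the
    original one.\<close>
  define h' s' where "h' k i = (\<not> h k i)" and "s' i = (\<not> s i)" for k i
  have h: "h = (\<lambda>k i. \<not> h' k i)" by (simp add: h'_def)
  have e: "((\<lambda>i. \<not> Psi k \<omega> i) = g) = (Psi k \<omega> = (\<lambda>i. \<not> g i))" for k \<omega> g by (auto simp: fun_eq_iff)
  have "fbias (mu A (beta flip_b1 h t) i) (flip_gam $ i) = 1 - fbias (mu A (bt h' t) i) (gam $ i)" for i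
    unfolding h beta_flip mu_flip flip_gam_def using mu_bt_range[of h' t i] gam_pos[of i]
    by (simp add: fbias_flip)
  then have p: "(\<Prod>i\<in>UNIV. let p = fbias (mu A (beta flip_b1 h t) i) (flip_gam $ i) in if s i then p else 1 - p)
     = (\<Prod>i\<in>UNIV. let p = fbias (mu A (bt h' t) i) (gam $ i) in if s' i then p else 1 - p)"
    by (intro prod.cong) (auto simp: Let_def s'_def)
  show "prob {\<omega> \<in> space M. (\<forall>k\<in>{2..t}. (\<lambda>i. \<not> Psi k \<omega> i) = h k) \<and> (\<lambda>i. \<not> Psi (Suc t) \<omega> i) = s}
     = prob {\<omega> \<in> space M. \<forall>k\<in>{2..t}. (\<lambda>i. \<not> Psi k \<omega> i) = h k}
       * (\<Prod>i\<in>UNIV. let p = fbias (mu A (beta flip_b1 h t) i) (flip_gam $ i) in if s i then p else 1 - p)"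
    unfolding e p using dyn[OF t, of h' s'] unfolding h'_def s'_def .
qed

lemma tendsto_flip:
  "(\<lambda>t. beta flip_b1 (\<lambda>k i. \<not> h k i) t) \<longlonglongrightarrow> vec 1 - x \<longleftrightarrow> (\<lambda>t. bt h t) \<longlonglongrightarrow> x"
  unfolding beta_flip
proof
  assume "(\<lambda>t. vec 1 - bt h t) \<longlonglongrightarrow> vec 1 - x"
  from tendsto_diff[OF tendsto_const[of "vec 1"] this] show "(\<lambda>t. bt h t) \<longlonglongrightarrow> x" by simp
qed (intro tendsto_intros)

text \<open>If \<open>lambda_max\<close> is at most \<open>1\<close> at \<open>vec 0\<close>, it
  exceeds \<open>1\<close> at \<open>vec 1\<close>, and instability for the flipped process rules
  out the limit \<open>vec 1\<close>.\<close>

lemma AE_tendsto_zero: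
  assumes ne: "\<exists>i. gam $ i \<noteq> 1" and le1: "lambda_max (Jac A gam (vec 0)) \<le> 1"
  shows "AE \<omega> in M. (\<lambda>t. bt (decl \<omega>) t) \<longlonglongrightarrow> vec 0"
proof -
  interpret flip: opinion_process A M flip_gam flip_b1 "\<lambda>t \<omega> i. \<not> Psi t \<omega> i"
    by (rule opinion_process_flip)
  have "lambda_max (Jac A flip_gam (vec 0)) > 1"
    unfolding flip_gam_def by (rule lambda_max_inverse[OF gam_pos ne le1])
  from flip.AE_not_tendsto_zero[OF this] AE_tendsto_vertex[OF ne le1]
  show ?thesis
    by eventually_elim (use tendsto_flip[where x = "vec 1"] in auto)
qed

end

theorem theorem3:
  fixes A :: "real^'n^'n" and gam b1 x :: "real^'n"
    and M :: "'a measure" and Psi :: "nat \<Rightarrow> 'a \<Rightarrow> 'n \<Rightarrow> bool"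
  assumes sym: "\<forall>i j. A $ i $ j = A $ j $ i"
    and nonneg: "\<forall>i j. A $ i $ j \<ge> 0"
    and conn: "graph_connected A"
    and nonbip: "\<not> graph_bipartite A"
    and gam_pos: "\<forall>i. gam $ i > 0"
    and gam_ne: "\<exists>i. gam $ i \<noteq> 1"
    and init: "\<forall>i. 0 < b1 $ i \<and> b1 $ i < 1"
    and P: "prob_space M"
    and meas: "\<forall>t i. (\<lambda>\<omega>. Psi t \<omega> i) \<in> M \<rightarrow>\<^sub>M count_space UNIV"
    and dyn: "\<forall>t \<ge> 1. \<forall>(h :: nat \<Rightarrow> 'n \<Rightarrow> bool) (s :: 'n \<Rightarrow> bool).
       measure M {\<omega> \<in> space M. (\<forall>k\<in>{2..t}. Psi k \<omega> = h k) \<and> Psi (Suc t) \<omega> = s}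
       = measure M {\<omega> \<in> space M. \<forall>k\<in>{2..t}. Psi k \<omega> = h k}
         * (\<Prod>i\<in>UNIV. let p = fbias (mu A (beta b1 h t) i) (gam $ i)
                        in if s i then p else 1 - p)"
    and x: "x = vec 0 \<or> x = vec 1"
  shows "(lambda_max (Jac A gam x) > 1 \<longrightarrow>
            (AE \<omega> in M. \<not> (\<lambda>t. beta b1 (\<lambda>k. Psi k \<omega>) t) \<longlonglongrightarrow> x))
       \<and> (lambda_max (Jac A gam x) \<le> 1 \<longrightarrow>
            (AE \<omega> in M. (\<lambda>t. beta b1 (\<lambda>k. Psi k \<omega>) t) \<longlonglongrightarrow> x))"
proof -
  interpret prob_space M by (rule P)
  interpret opinion_process A M gam b1 Psi
    by unfold_locales (use sym nonneg conn nonbip gam_pos init meas dyn in auto)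
  show ?thesis
  proof (cases "x = vec 0")
    case True
    then show ?thesis using AE_not_tendsto_zero AE_tendsto_zero[OF gam_ne] by simp
  next
    case False
    interpret flip: opinion_process A M flip_gam flip_b1 "\<lambda>t \<omega> i. \<not> Psi t \<omega> i"
      by (rule opinion_process_flip)
    have x1: "x = vec 1" using x False by simp
    \<comment> \<open>The second branch of \<open>Jac\<close> is its first branch for the inverted
      bias parameters.\<close>
    have J: "Jac A gam x = Jac A flip_gam (vec 0)"
      using False by (simp add: Jac_def flip_gam_def)
    have ne: "\<exists>i. flip_gam $ i \<noteq> 1" using gam_ne by (auto simp: flip_gam_def)
    have tf: "(\<lambda>t. beta flip_b1 (\<lambda>k i. \<not> h k i) t) \<longlonglongrightarrow> vec 0 \<longleftrightarrow> (\<lambda>t. beta b1 h t) \<longlonglongrightarrow> x" for h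
      using tendsto_flip[of h "vec 1"] by (simp add: x1)
    show ?thesis
      using flip.AE_not_tendsto_zero flip.AE_tendsto_zero[OF ne] unfolding J tf by blast
  qed
qed

end
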